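(* Let $q$ and $b$ be integers such that $q\ge 2$, $q$ divides $b$, $b/q\ge 2$, and $b>4$. Let $\kappa:\Sigma_q^\ast\to\{-1,0,1,\ldots,b-2\}$ be the tree mapping defined as follows. Put $\kappa(0^n)=0$ for all $n\ge1$. Every other word in $\Sigma_q^\ast$ is uniquely of the form $\delta0^k$ with $k\ge0$ and $\delta\in\Sigma_q^n$, $n\ge1$, whose last letter is $j\in\{1,\ldots,q-1\}$; inductively on $n$, for such $\delta$ put $$\kappa(\delta0^k)=\begin{cases} j & \text{if } k=0,\\ q & \text{if } k\in\{1,2,\ldots,K_\delta\}\cup\{n+2b-1\},\\ 0 & \text{if } k>K_\delta \text{ and } k\ne n+2b-1,\end{cases}$$ where $K_\delta\in\{0,1,\ldots,b-2\}$ is the unique integer such that $$\sum_{i=1}^{n-1}\kappa(\delta|_i)+q(K_\delta+1)+j\in(b-1)\mathbb Z$$ (the sum being empty if $n=1$). Let $$\Lambda_{q,b}:=\Big\{\sum_{k=1}^\infty\kappa(\delta|_k)b^{k-1}:\ \delta\in\Sigma_q^\ast\Big\}.$$ Then $\Lambda_{q,b}$ is a spectrum of the Cantor measure $\mu_{q,b}$, and the rescaled set $\Lambda_{q,b}/(b-1)=\{\lambda/(b-1):\lambda\in\Lambda_{q,b}\}$ is a maximal orthogonal set of $\mu_{q,b}$ but not a spectrum of $\mu_{q,b}$.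
   Context: Cantor measure: $\mu_{q,b}$ is the unique Borel probability measure on $\mathbb R$ with $\mu_{q,b}=\frac1q\sum_{i=0}^{q-1}\mu_{q,b}(f_i^{-1}(\cdot))$, where $f_i(x)=x/b+i/q$, $0\le i\le q-1$. A countable set $\Lambda\subset\mathbb R$ is a spectrum of a probability measure $\mu$ if $\{e^{-2\pi i\lambda x}:\lambda\in\Lambda\}$ is an orthogonal basis of $L^2(\mu)$. It is an orthogonal set of $\mu$ if the functions $e^{-2\pi i\lambda x}$, $\lambda\in\Lambda$, are pairwise orthogonal in $L^2(\mu)$, and a maximal orthogonal set if moreover no $\Lambda\cup\{\lambda_0\}$ with $\lambda_0\in\mathbb R\setminus\Lambda$ is an orthogonal set of $\mu$. Words: $\Sigma_q=\{0,1,\ldots,q-1\}$; $\Sigma_q^n$ is the set of words of length $n$ over $\Sigma_q$; $\Sigma_q^\ast=\bigcup_{1\le n<\infty}\Sigma_q^n$. Juxtaposition denotes concatenation; $0^k$ is the word of $k$ zeros (with $\delta0^0=\delta$) and $0^\infty=000\cdots$. For $\delta\in\Sigma_q^\ast$ and $k\ge1$, $\delta|_k$ is the prefix of length $k$ of $\delta0^\infty$. Tree mapping: a map $\tau:\Sigma_q^\ast\to\{-1,0,\ldots,b-2\}$ with (i) $\tau(0^n)=0$ for all $n\ge1$; (ii) $\tau(\delta)\in\delta_n+q\mathbb Z$ for every $\delta=\delta_1\cdots\delta_n\in\Sigma_q^n$, $n\ge1$. *)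

theory Defs
  imports "HOL-Probability.Probability"
begin

section \<open>Spectra and orthogonal sets of a probability measure on the real line\<close>

definition expo :: "real \<Rightarrow> real \<Rightarrow> complex" where
  "expo l x = exp (- 2 * complex_of_real pi * \<i> * complex_of_real (l * x))"

text \<open>
  The library has no space \<open>L\<^sup>2(M)\<close>; its elements are represented by square-integrable
  functions, and almost everywhere equality is absorbed by working with inner products and the norm.
\<close>

definition L2_space :: "'a measure \<Rightarrow> ('a \<Rightarrow> complex) set" where
  "L2_space M = {f \<in> borel_measurable M. integrable M (\<lambda>x. (cmod (f x))\<^sup>2)}"

definition L2_inner :: "'a measure \<Rightarrow> ('a \<Rightarrow> complex) \<Rightarrow> ('a \<Rightarrow> complex) \<Rightarrow> complex" where
  "L2_inner M f g = (\<integral>x. f x * cnj (g x) \<partial>M)"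

definition L2_norm :: "'a measure \<Rightarrow> ('a \<Rightarrow> complex) \<Rightarrow> real" where
  "L2_norm M f = sqrt (\<integral>x. (cmod (f x))\<^sup>2 \<partial>M)"

definition orthogonal_set :: "real measure \<Rightarrow> real set \<Rightarrow> bool" where
  "orthogonal_set M L \<longleftrightarrow>
     countable L \<and> pairwise (\<lambda>l l'. L2_inner M (expo l) (expo l') = 0) L"

definition maximal_orthogonal_set :: "real measure \<Rightarrow> real set \<Rightarrow> bool" where
  "maximal_orthogonal_set M L \<longleftrightarrow>
     orthogonal_set M L \<and> (\<forall>l0. l0 \<notin> L \<longrightarrow> \<not> orthogonal_set M (insert l0 L))"

text \<open>
  An orthogonal basis is an orthogonal family (of nonzero vectors, which is automatic here) whose
  finite linear combinations are dense in \<open>L\<^sup>2(M)\<close>.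
\<close>

definition is_spectrum :: "real measure \<Rightarrow> real set \<Rightarrow> bool" where
  "is_spectrum M L \<longleftrightarrow> orthogonal_set M L \<and>
     (\<forall>f \<in> L2_space M. \<forall>\<epsilon>>0. \<exists>F c. finite F \<and> F \<subseteq> L \<and>
        L2_norm M (\<lambda>x. f x - (\<Sum>l\<in>F. c l * expo l x)) < \<epsilon>)"


section \<open>The Cantor measure\<close>

definition cantor_map :: "nat \<Rightarrow> nat \<Rightarrow> nat \<Rightarrow> real \<Rightarrow> real" where
  "cantor_map q b i x = x / real b + real i / real q"

definition is_cantor_measure :: "nat \<Rightarrow> nat \<Rightarrow> real measure \<Rightarrow> bool" where
  "is_cantor_measure q b M \<longleftrightarrow> prob_space M \<and> sets M = sets borel \<and>
     (\<forall>A \<in> sets borel.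
        measure M A = 1 / real q * (\<Sum>i<q. measure M (cantor_map q b i -` A)))"

definition cantor_measure :: "nat \<Rightarrow> nat \<Rightarrow> real measure" where
  "cantor_measure q b = (THE M. is_cantor_measure q b M)"


section \<open>Words and tree mappings\<close>

text \<open>Words are lists of letters; the empty list is not a word.\<close>

definition words :: "nat \<Rightarrow> nat list set" where
  "words q = {w. w \<noteq> [] \<and> set w \<subseteq> {0..<q}}"

text \<open>The prefix of length \<open>k\<close> of \<open>w 0\<^sup>\<infinity>\<close>.\<close>

definition prefix0 :: "nat \<Rightarrow> nat list \<Rightarrow> nat list" where
  "prefix0 k w = take k (w @ replicate k 0)"

lemma length_prefix0 [simp]: "length (prefix0 k w) = k"
  by (simp add: prefix0_def)

definition tree_mapping :: "nat \<Rightarrow> nat \<Rightarrow> (nat list \<Rightarrow> int) \<Rightarrow> bool" where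
  "tree_mapping q b t \<longleftrightarrow>
     (\<forall>w \<in> words q. t w \<in> {-1 .. int b - 2}) \<and>
     (\<forall>n\<ge>1. t (replicate n 0) = 0) \<and>
     (\<forall>w \<in> words q. int q dvd t w - int (last w))"


section \<open>The mapping \<open>\<kappa>\<close> and the set \<open>\<Lambda>\<close>\<close>

text \<open>The word \<open>\<delta>\<close> in the decomposition \<open>w = \<delta> 0\<^sup>k\<close>; empty iff \<open>w\<close> consists of zeros only.\<close>

definition strip0 :: "nat list \<Rightarrow> nat list" where
  "strip0 w = rev (dropWhile (\<lambda>a. a = 0) (rev w))"

lemma length_strip0_le: "length (strip0 w) \<le> length w"
  using length_dropWhile_le[of "\<lambda>a. a = 0" "rev w"] by (simp add: strip0_def)

text \<open>The number \<open>K\<^sub>\<delta>\<close>, where \<open>s\<close> is the sum of \<open>\<kappa>\<close> over the proper prefixes of \<open>\<delta>\<close>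
  and \<open>j\<close> is the last letter of \<open>\<delta>\<close>.\<close>

definition K_index :: "nat \<Rightarrow> nat \<Rightarrow> int \<Rightarrow> nat \<Rightarrow> nat" where
  "K_index q b s j =
     (THE K. K \<in> {0..b - 2} \<and> int b - 1 dvd s + int q * (int K + 1) + int j)"

function kappa :: "nat \<Rightarrow> nat \<Rightarrow> nat list \<Rightarrow> int" where
  "kappa q b w =
     (let d = strip0 w; n = length d; k = length w - n; j = last d
      in if d = [] then 0
         else if k = 0 then int j
         else let K = K_index q b (\<Sum>i = 1..n - 1. kappa q b (prefix0 i d)) j
              in if k \<in> {1..K} \<union> {n + 2 * b - 1} then int q else 0)"
  by pat_completeness auto
termination
proof (relation "Wellfounded.measure (\<lambda>(q, b, w). length w)", goal_cases)
  case 1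
  show ?case by simp
next
  case (2 q b w d n k j i)
  then have "i < length d" by (cases d) auto
  with 2 length_strip0_le[of w] show ?case by simp
qed

declare kappa.simps [simp del]

lemma kappa_zeros: "kappa q b (replicate n 0) = 0"
  by (simp add: kappa.simps strip0_def)

lemma strip0_append:
  assumes "d \<noteq> []" and "last d \<noteq> 0"
  shows "strip0 (d @ replicate k 0) = d"
proof -
  have "dropWhile (\<lambda>a. a = 0) (rev d) = rev d"
    using assms by (cases "rev d") (auto simp: hd_rev[symmetric])
  then show ?thesis
    by (simp add: strip0_def dropWhile_append)
qed

lemma kappa_append_zeros:
  assumes "d \<noteq> []" and "last d \<noteq> 0"
  shows "kappa q b (d @ replicate k 0) =
    (if k = 0 then int (last d)
     else if k \<in> {1..K_index q b (\<Sum>i = 1..length d - 1. kappa q b (prefix0 i d)) (last d)}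
               \<union> {length d + 2 * b - 1} then int q
     else 0)"
  by (subst kappa.simps) (simp add: strip0_append assms Let_def)

lemma words_cases:
  assumes "w \<in> words q"
  obtains (zeros) n where "n \<ge> 1" "w = replicate n 0"
  | (append) d k where "d \<in> words q" "last d \<noteq> 0" "w = d @ replicate k 0"
proof -
  let ?z = "takeWhile (\<lambda>a. a = 0) (rev w)"
  have z: "?z = replicate (length ?z) 0"
    by (metis (mono_tags, lifting) replicate_length_same set_takeWhileD)
  have "rev w = ?z @ rev (strip0 w)"
    by (simp add: strip0_def)
  then have w: "w = strip0 w @ replicate (length ?z) 0"
    using z by (metis rev_append rev_replicate rev_rev_ident)
  show thesis
  proof (cases "strip0 w = []")
    case True
    with w assms show thesis
      by (intro zeros[of "length ?z"]) (auto simp: words_def Suc_le_eq)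
  next
    case False
    then have "last (strip0 w) \<noteq> 0"
      using hd_dropWhile[of "\<lambda>a. a = 0" "rev w"] by (simp add: strip0_def last_rev)
    moreover have "strip0 w \<in> words q"
      using False assms w by (metis (mono_tags, lifting) le_sup_iff mem_Collect_eq set_append words_def)
    ultimately show thesis using w append by blast
  qed
qed

lemma ex1_K_index:
  assumes "q dvd b" and "b > 1"
  shows "\<exists>!K. K \<in> {0..b - 2} \<and> int b - 1 dvd s + int q * (int K + 1) + int j"
proof -
  define m where "m = int b - 1"
  have m: "m > 0" using assms by (simp add: m_def)
  obtain p where p: "b = q * p" using assms by blast
  have qp: "int q * int p = m + 1" by (simp add: m_def p)
  have key: "m dvd s + int q * (x + 1) + int j \<longleftrightarrow> m dvd x + (1 + int p * (s + int j))" for x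
  proof
    assume "m dvd s + int q * (x + 1) + int j"
    then have "m dvd int p * (s + int q * (x + 1) + int j) - m * (x + 1)"
      by (intro dvd_diff) auto
    also have "int p * (s + int q * (x + 1) + int j) - m * (x + 1)
      = int p * (s + int j) + (int q * int p) * (x + 1) - m * (x + 1)" by (simp add: algebra_simps)
    also have "\<dots> = x + (1 + int p * (s + int j))" unfolding qp by (simp add: algebra_simps)
    finally show "m dvd x + (1 + int p * (s + int j))" .
  next
    assume "m dvd x + (1 + int p * (s + int j))"
    then have "m dvd int q * (x + (1 + int p * (s + int j))) - m * (s + int j)"
      by (intro dvd_diff) auto
    also have "int q * (x + (1 + int p * (s + int j))) - m * (s + int j)
      = int q * (x + 1) + (int q * int p) * (s + int j) - m * (s + int j)"
      by (simp add: algebra_simps)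
    also have "\<dots> = s + int q * (x + 1) + int j" unfolding qp by (simp add: algebra_simps)
    finally show "m dvd s + int q * (x + 1) + int j" .
  qed
  define r where "r = 1 + int p * (s + int j)"
  have iff: "(K \<in> {0..b - 2} \<and> m dvd s + int q * (int K + 1) + int j) \<longleftrightarrow> K = nat (- r mod m)" for K
  proof
    assume a: "K \<in> {0..b - 2} \<and> m dvd s + int q * (int K + 1) + int j"
    then have "m dvd int K - - r" by (simp only: key r_def diff_minus_eq_add)
    then have "int K mod m = - r mod m" by (simp add: mod_eq_dvd_iff)
    moreover have "int K < m" using a assms by (auto simp: m_def)
    ultimately show "K = nat (- r mod m)" by simp
  next
    assume K: "K = nat (- r mod m)"
    then have i: "int K = - r mod m" using m by simp
    then have "int K < m" using m by simp
    then have "K \<in> {0..b - 2}" by (auto simp: m_def)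
    moreover have "int K mod m = - r mod m" using i by simp
    then have "m dvd int K - - r" by (simp only: mod_eq_dvd_iff)
    ultimately show "K \<in> {0..b - 2} \<and> m dvd s + int q * (int K + 1) + int j"
      by (simp only: key r_def diff_minus_eq_add)
  qed
  show ?thesis unfolding m_def[symmetric] iff by blast
qed

lemma tree_mapping_kappa:
  assumes "q \<ge> 2" and "q dvd b" and "b div q \<ge> 2"
  shows "tree_mapping q b (kappa q b)"
proof -
  have "2 * q \<le> b" using assms by (metis dvd_div_mult_self mult_le_mono1)
  then have *: "int q \<le> int b - 2" using assms(1) by simp
  have "kappa q b w \<in> {-1 .. int b - 2} \<and> int q dvd kappa q b w - int (last w)"
    if "w \<in> words q" for w
    using that
  proof (cases rule: words_cases)
    case (zeros n)
    then show ?thesis using * by (simp add: kappa_zeros)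
  next
    case (append d k)
    then have "d \<noteq> []" "set d \<subseteq> {0..<q}" by (auto simp: words_def)
    moreover from this have "last d < q" using last_in_set[of d] by fastforce
    ultimately show ?thesis using append * by (auto simp: kappa_append_zeros)
  qed
  then show ?thesis by (simp add: tree_mapping_def kappa_zeros)
qed

text \<open>The index is shifted by one; all but finitely many terms vanish.\<close>

definition Lambda_set :: "nat \<Rightarrow> nat \<Rightarrow> real set" where
  "Lambda_set q b =
     {\<Sum>k. real_of_int (kappa q b (prefix0 (Suc k) d)) * real b ^ k | d. d \<in> words q}"

end

theory Submission
  imports Defs
begin

text \<open>
  The transform of \<open>\<mu>\<close> is the product of the masks \<open>m(x / b^j)\<close>, where \<open>m\<close> is \<open>q\<close>-periodic, vanishes
  exactly on the integers not divisible by \<open>q\<close>, and satisfies \<open>\<Sum>\<^sub>i |m(x + d\<^sub>i)|\<^sup>2 = 1\<close> over complete residue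
  systems. Hence a set of integers organised as a \<open>q\<close>-ary tree in base \<open>b\<close> is orthogonal, and the first
  \<open>n\<close> factors of the product, summed over the words of length \<open>n\<close>, give exactly \<open>1\<close>. Whether the Bessel sum
  of the full set equals \<open>1\<close> is decided by the remaining factors. For \<open>\<Lambda>\<close> they are bounded below,
  since beyond the length of a word the digits are at most \<open>b\<close> copies of \<open>q\<close> and zeros. For \<open>\<Lambda> / (b - 1)\<close>,
  which is again a tree of integers because \<open>b - 1\<close> divides \<open>\<Lambda>\<close>, the last digit \<open>q\<close> in position \<open>N\<close> turns
  into a block of digits \<open>q\<close> below \<open>N\<close> whose length exceeds that of the word; so the remaining factors
  decay geometrically in the word length and the Bessel sum stays below \<open>1\<close>. Maximality of \<open>\<Lambda> / (b - 1)\<close>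
  follows from that of the spectrum \<open>\<Lambda>\<close>, as multiplication by \<open>b - 1\<close> preserves the zeros of the
  transform.
\<close>

section \<open>The mask of the Cantor measure\<close>

text \<open>The shape of \<open>kappa\<close> meets two demands. As b is 1 modulo b - 1,
  divisibility of a frequency by b - 1 is a condition on its digit sum, and q is invertible modulo b
  - 1, with inverse b/q; so some number K + 1 of digits q can repair the sum without touching the
  residues modulo q on which orthogonality rests. Their positions are immaterial for divisibility.
  The lower bound for Lambda only counts the nonzero digits behind the word, so one of them may be
  sent far away, and it is this one that ruins the rescaled set. The two estimates are not
  symmetric. The lower bound has to hold for all words of a level; the upper one cannot, since for
  words of zeros the integer is 0 and the remaining factors tend to 1. Levels are therefore nested
  by padding with zeros, and the defect is followed only through the words that are new at each
  level, whose last letter is nonzero. The hypothesis b > 4 enters as b >= 6, which gives q / (b -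
  1) <= 3/5. Reduced modulo q, the arguments of the mask then stay within [-2/3, 2/3] in the lower
  bound and below 1 in the upper one.\<close>

lemma expo_cis: "expo l x = cis (- (2 * pi * (l * x)))"
  by (simp add: expo_def cis_conv_exp algebra_simps)

lemma expo_0 [simp]: "expo 0 x = 1" "expo l 0 = 1"
  by (simp_all add: expo_def)

lemma norm_expo [simp]: "cmod (expo l x) = 1"
  by (simp add: expo_cis)

lemma expo_add_left: "expo (l + l') x = expo l x * expo l' x"
  by (simp add: expo_cis cis_mult algebra_simps)

lemma expo_add_right: "expo l (x + y) = expo l x * expo l y"
  by (simp add: expo_cis cis_mult algebra_simps)

lemma cnj_expo: "cnj (expo l x) = expo (- l) x"
  by (simp add: expo_cis cis_cnj)

lemma expo_mult_cnj: "expo l x * cnj (expo l' x) = expo (l - l') x"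
  by (simp add: cnj_expo expo_add_left [symmetric])

lemma expo_eq_1_iff: "expo l x = 1 \<longleftrightarrow> l * x \<in> \<int>"
proof
  assume "expo l x = 1"
  then have "cos (2 * pi * (l * x)) = 1"
    by (simp add: expo_cis complex_eq_iff)
  then obtain k :: int where "2 * pi * (l * x) = of_int k * (2 * pi)"
    by (auto simp: cos_one_2pi_int)
  then show "l * x \<in> \<int>" by simp
next
  assume "l * x \<in> \<int>"
  then obtain k :: int where "l * x = of_int k" by (auto elim: Ints_cases)
  then have "- (2 * pi * (l * x)) = 2 * pi * of_int (- k)" by simp
  then show "expo l x = 1"
    unfolding expo_cis by (simp only: cis_multiple_2pi Ints_of_int)
qed

lemma continuous_expo_left: "continuous_on S (\<lambda>l. expo l x)"
  unfolding expo_def by (intro continuous_intros)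

lemma continuous_expo_right: "continuous_on S (expo l)"
  unfolding expo_def by (intro continuous_intros)

lemma borel_measurable_expo [measurable]: "expo l \<in> borel_measurable borel"
  by (intro borel_measurable_continuous_onI continuous_expo_right)

lemma norm_one_minus_expo: "cmod (1 - expo l x) = 2 * \<bar>sin (pi * (l * x))\<bar>"
proof -
  have "(cmod (1 - expo l x))\<^sup>2 = (1 - cos (2 * (pi * (l * x))))\<^sup>2 + (sin (2 * (pi * (l * x))))\<^sup>2"
    by (simp add: expo_cis cmod_power2 algebra_simps)
  also have "\<dots> = 2 - 2 * cos (2 * (pi * (l * x)))"
    using sin_cos_squared_add[of "2 * (pi * (l * x))"] by (simp add: power2_eq_square algebra_simps)
  also have "\<dots> = (2 * \<bar>sin (pi * (l * x))\<bar>)\<^sup>2"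
    unfolding cos_double_sin by (simp add: power_mult_distrib)
  finally show ?thesis by (rule power2_eq_imp_eq) simp_all
qed

text \<open>The Fourier transform of the uniform probability measure on the points i/q, the
  translations in \<open>cantor_map\<close>.\<close>

definition cantor_mask :: "nat \<Rightarrow> real \<Rightarrow> complex" where
  "cantor_mask q x = (\<Sum>i<q. expo x (real i / real q)) / of_nat q"

lemma cantor_mask_0: "q > 0 \<Longrightarrow> cantor_mask q 0 = 1"
  by (simp add: cantor_mask_def)

lemma expo_of_nat_div: "expo x (real i / real q) = expo x (1 / real q) ^ i"
  by (induction i) (simp_all add: add_divide_distrib expo_add_right)

lemma cantor_mask_periodic: "q > 0 \<Longrightarrow> cantor_mask q (x + real q * of_int k) = cantor_mask q x"
proof -
  assume "q > 0"
  have "expo (real q * of_int k) (real i / real q) = 1" for i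
    using \<open>q > 0\<close> unfolding expo_eq_1_iff by simp
  then show ?thesis by (simp add: cantor_mask_def expo_add_left)
qed

lemma continuous_cantor_mask: "continuous_on S (cantor_mask q)"
  unfolding cantor_mask_def divide_inverse by (intro continuous_intros continuous_expo_left)

lemma norm_cantor_mask_le_1: "cmod (cantor_mask q x) \<le> 1"
proof -
  have "cmod (\<Sum>i<q. expo x (real i / real q)) \<le> (\<Sum>i<q. 1)"
    by (rule sum_norm_le) simp
  then show ?thesis by (cases "q = 0") (simp_all add: cantor_mask_def norm_divide)
qed

text \<open>The geometric sum, kept free of division so that it also covers the case
  \<open>expo x (1 / real q) = 1\<close>.\<close>

lemma cantor_mask_mult_one_minus:
  "q > 0 \<Longrightarrow> of_nat q * cantor_mask q x * (1 - expo x (1 / real q)) = 1 - expo x 1"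
proof -
  assume "q > 0"
  then have "of_nat q * cantor_mask q x = (\<Sum>i<q. expo x (1 / real q) ^ i)"
    unfolding cantor_mask_def expo_of_nat_div[of x _ q] by simp
  moreover have "expo x (1 / real q) ^ q = expo x 1"
    using expo_of_nat_div[of x q q] \<open>q > 0\<close> by simp
  ultimately show ?thesis
    using one_diff_power_eq[of "expo x (1 / real q)" q] by (simp add: mult.commute)
qed

lemma cantor_mask_of_int:
  assumes "q > 0"
  shows "cantor_mask q (of_int k) = (if int q dvd k then 1 else 0)"
proof (cases "int q dvd k")
  case True
  then obtain r where "k = int q * r" by blast
  then show ?thesis using cantor_mask_periodic[OF assms, of 0 r] assms True by (simp add: cantor_mask_0)
next
  case False
  have "expo (of_int k) (1 / real q) \<noteq> 1"
  proof
    assume "expo (of_int k) (1 / real q) = 1"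
    then obtain r :: int where "of_int k / real q = of_int r"
      by (auto simp: expo_eq_1_iff elim: Ints_cases)
    then have "real_of_int k = real_of_int (int q * r)" using assms by (simp add: field_simps)
    then have "k = int q * r" by linarith
    with False show False by simp
  qed
  moreover have "expo (of_int k) 1 = 1" by (simp add: expo_eq_1_iff)
  ultimately show ?thesis using cantor_mask_mult_one_minus[OF assms, of "of_int k"] False assms by simp
qed

lemma cantor_mask_eq_0_iff:
  assumes "q > 0"
  shows "cantor_mask q x = 0 \<longleftrightarrow> (\<exists>k::int. x = of_int k \<and> \<not> int q dvd k)"
proof
  assume 0: "cantor_mask q x = 0"
  then have "expo x 1 = 1" using cantor_mask_mult_one_minus[OF assms, of x] by simp
  then obtain k :: int where "x = of_int k" by (auto simp: expo_eq_1_iff elim: Ints_cases)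
  with 0 show "\<exists>k::int. x = of_int k \<and> \<not> int q dvd k"
    using cantor_mask_of_int[OF assms, of k] by (auto split: if_splits)
qed (auto simp: cantor_mask_of_int[OF assms])

lemma sum_norm_cantor_mask_consecutive:
  assumes "q > 0"
  shows "(\<Sum>k<q. (cmod (cantor_mask q (x + real k)))\<^sup>2) = 1"
proof -
  \<comment> \<open>Orthogonality of the characters of Z/q: exchanging frequency and position turns
    the sum over k into q times the mask at the integer i - j.\<close>
  have dual: "(\<Sum>k<q. expo (real k) ((real i - real j) / real q)) = (if i = j then of_nat q else 0)"
    if "i < q" "j < q" for i j
  proof -
    have "(\<Sum>k<q. expo (real k) ((real i - real j) / real q))
        = (\<Sum>k<q. expo (of_int (int i - int j)) (real k / real q))"
      by (simp add: expo_def mult.commute)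
    also have "\<dots> = of_nat q * cantor_mask q (of_int (int i - int j))"
      using assms by (simp add: cantor_mask_def)
    also have "\<dots> = (if i = j then of_nat q else 0)"
    proof -
      have "int q dvd int i - int j \<longleftrightarrow> i = j"
        using that zdvd_imp_le[of "int q" "\<bar>int i - int j\<bar>"] by (cases "i = j") auto
      then show ?thesis by (simp only: cantor_mask_of_int[OF assms]) simp
    qed
    finally show ?thesis .
  qed
  have "complex_of_real ((real q)\<^sup>2 * (\<Sum>k<q. (cmod (cantor_mask q (x + real k)))\<^sup>2))
      = (\<Sum>k<q. (of_nat q * cantor_mask q (x + real k)) * cnj (of_nat q * cantor_mask q (x + real k)))"
    by (simp add: sum_distrib_left complex_norm_square power2_eq_square[of "real q"]
        mult_ac del: of_real_power)
  also have "\<dots> = (\<Sum>k<q. \<Sum>i<q. \<Sum>j<q.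
      expo x ((real i - real j) / real q) * expo (real k) ((real i - real j) / real q))"
  proof (intro sum.cong refl)
    fix k
    have *: "of_nat q * cantor_mask q (x + real k) = (\<Sum>i<q. expo (x + real k) (real i / real q))"
      using assms by (simp add: cantor_mask_def)
    have "expo (x + real k) (real i / real q) * cnj (expo (x + real k) (real j / real q))
       = expo x ((real i - real j) / real q) * expo (real k) ((real i - real j) / real q)" for i j
    proof -
      have "cnj (expo (x + real k) (real j / real q)) = expo (x + real k) (- (real j / real q))"
        unfolding cnj_expo by (simp only: expo_cis mult_minus_left mult_minus_right)
      then show ?thesis
        by (simp add: expo_add_right[symmetric] expo_add_left[symmetric] diff_divide_distrib)
    qed
    then show "of_nat q * cantor_mask q (x + real k) * cnj (of_nat q * cantor_mask q (x + real k)) = (\<Sum>i<q. \<Sum>j<q.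
      expo x ((real i - real j) / real q) * expo (real k) ((real i - real j) / real q))"
      unfolding * cnj_sum sum_product by simp
  qed
  also have "\<dots> = (\<Sum>i<q. \<Sum>k<q. \<Sum>j<q.
      expo x ((real i - real j) / real q) * expo (real k) ((real i - real j) / real q))"
    by (rule sum.swap)
  also have "\<dots> = (\<Sum>i<q. \<Sum>j<q. \<Sum>k<q.
      expo x ((real i - real j) / real q) * expo (real k) ((real i - real j) / real q))"
    by (rule sum.cong[OF refl], rule sum.swap)
  also have "\<dots> = (\<Sum>i<q. \<Sum>j<q. expo x ((real i - real j) / real q) * (if i = j then of_nat q else 0))"
    by (intro sum.cong refl) (simp add: sum_distrib_left[symmetric] dual)
  also have "\<dots> = (\<Sum>i<q. of_nat q)"
  proof (rule sum.cong[OF refl])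
    fix i assume "i \<in> {..<q}"
    then show "(\<Sum>j<q. expo x ((real i - real j) / real q) * (if i = j then of_nat q else 0)) = complex_of_nat q"
      by (subst sum.remove[of _ i]) (auto intro!: sum.neutral)
  qed
  also have "\<dots> = complex_of_real ((real q)\<^sup>2 * 1)"
    by (simp add: power2_eq_square)
  finally have "(real q)\<^sup>2 * (\<Sum>k<q. (cmod (cantor_mask q (x + real k)))\<^sup>2) = (real q)\<^sup>2 * 1"
    unfolding of_real_eq_iff .
  then show ?thesis using assms by simp
qed

text \<open>By periodicity only residues modulo q count, and q pairwise incongruent numbers run
  through all of them.\<close>

lemma sum_norm_cantor_mask:
  assumes "q > 0"
    and inj: "\<And>i j. i < q \<Longrightarrow> j < q \<Longrightarrow> int q dvd d i - d j \<Longrightarrow> i = j"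
  shows "(\<Sum>i<q. (cmod (cantor_mask q (x + of_int (d i))))\<^sup>2) = 1"
proof -
  define r where "r i = nat (d i mod int q)" for i
  have r: "int (r i) = d i mod int q" for i
    using assms(1) by (simp add: r_def)
  have "inj_on r {..<q}"
  proof (rule inj_onI)
    fix i j assume ij: "i \<in> {..<q}" "j \<in> {..<q}" "r i = r j"
    then have "d i mod int q = d j mod int q" using r by metis
    then show "i = j" using ij by (intro inj) (auto simp: mod_eq_dvd_iff)
  qed
  moreover have "r ` {..<q} \<subseteq> {..<q}"
    using assms(1) by (auto simp: r_def nat_less_iff)
  ultimately have bij: "bij_betw r {..<q} {..<q}"
    by (simp add: bij_betw_def endo_inj_surj)
  have "cantor_mask q (x + of_int (d i)) = cantor_mask q (x + real (r i))" for i
  proof -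
    have "d i = int (r i) + int q * (d i div int q)" by (simp add: r)
    then have "real_of_int (d i) = real (r i) + real q * of_int (d i div int q)"
      by (metis of_int_add of_int_mult of_int_of_nat_eq)
    then show ?thesis
      using cantor_mask_periodic[OF assms(1), of "x + real (r i)" "d i div int q"] by (simp add: add.assoc)
  qed
  then have "(\<Sum>i<q. (cmod (cantor_mask q (x + of_int (d i))))\<^sup>2) = (\<Sum>i<q. (cmod (cantor_mask q (x + real (r i))))\<^sup>2)"
    by simp
  also have "\<dots> = (\<Sum>k<q. (cmod (cantor_mask q (x + real k)))\<^sup>2)"
    by (rule sum.reindex_bij_betw[OF bij])
  finally show ?thesis using sum_norm_cantor_mask_consecutive[OF assms(1)] by simp
qed

section \<open>Bounds for the absolute value of the mask\<close>

lemma sin_ge_parabola: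
  assumes "0 \<le> t" and "t \<le> pi"
  shows "t * (1 - t / pi) \<le> sin t"
proof -
  \<comment> \<open>Both sides are invariant under t -> pi - t, so half of the interval suffices;
    there sin t >= t - t^3/6, and it remains that t/6 <= 1/pi.\<close>
  have *: "t * (1 - t / pi) \<le> sin t" if "0 \<le> t" "t \<le> pi / 2" for t :: real
  proof -
    \<comment> \<open>The bounds t <= pi/2 < 8/5 and pi < 16/5 already give 5.12.\<close>
    have "t * pi \<le> 6"
      using that mult_mono[of t "8/5" pi "32/10"] pi_less_4 pi_approx by simp
    then have "t / 6 \<le> 1 / pi" by (simp add: field_simps)
    then have "t\<^sup>2 * (t / 6) \<le> t\<^sup>2 * (1 / pi)"
      by (intro mult_left_mono) auto
    moreover have "t - t ^ 3 / 6 \<le> sin t"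
    proof -
      have "sin 0 - (0 - 0 ^ 3 / 6) \<le> sin t - (t - t ^ 3 / 6)"
      proof (rule DERIV_nonneg_imp_nondecreasing[OF that(1)])
        fix s :: real
        have "\<bar>sin (s / 2)\<bar>\<^sup>2 \<le> \<bar>s / 2\<bar>\<^sup>2"
          by (intro power_mono abs_sin_x_le_abs_x) auto
        then have "0 \<le> cos s - (1 - s\<^sup>2 / 2)"
          using cos_double_sin[of "s / 2"] by (simp add: power_divide)
        moreover have "((\<lambda>s. sin s - (s - s ^ 3 / 6)) has_real_derivative cos s - (1 - s\<^sup>2 / 2)) (at s)"
          by (auto intro!: derivative_eq_intros)
        ultimately show "\<exists>y. ((\<lambda>s. sin s - (s - s ^ 3 / 6)) has_real_derivative y) (at s) \<and> 0 \<le> y"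
          by blast
      qed
      then show ?thesis by simp
    qed
    moreover have "t * (1 - t / pi) = t - t\<^sup>2 * (1 / pi)" "t ^ 3 / 6 = t\<^sup>2 * (t / 6)"
      by (simp_all add: power2_eq_square power3_eq_cube right_diff_distrib)
    ultimately show ?thesis by linarith
  qed
  show ?thesis
  proof (cases "t \<le> pi / 2")
    case False
    have "t * (1 - t / pi) = (pi - t) * (1 - (pi - t) / pi)"
      by (simp add: field_simps)
    also have "\<dots> \<le> sin (pi - t)" using False assms by (intro *) auto
    finally show ?thesis by simp
  qed (use * assms in auto)
qed

text \<open>The absolute value is |sin(pi x)| / (q |sin(pi x / q)|) for x other than 0; bounding the
  sine in the denominator by its argument removes q, so the estimate is uniform in q.\<close>

lemma norm_cantor_mask_ge:
  assumes "q > 0" and "\<bar>x\<bar> \<le> 1"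
  shows "1 - \<bar>x\<bar> \<le> cmod (cantor_mask q x)"
proof (cases "x = 0")
  case True
  then show ?thesis using assms by (simp add: cantor_mask_0)
next
  case False
  have "pi * \<bar>x\<bar> * (1 - \<bar>x\<bar>) \<le> sin (pi * \<bar>x\<bar>)"
    using sin_ge_parabola[of "pi * \<bar>x\<bar>"] assms(2) by (simp add: mult_left_le)
  also have "\<dots> \<le> \<bar>sin (pi * x)\<bar>" by (cases "x \<ge> 0") auto
  also have "2 * \<dots> = real q * cmod (cantor_mask q x) * (2 * \<bar>sin (pi * (x * (1 / real q)))\<bar>)"
    using arg_cong[OF cantor_mask_mult_one_minus[OF assms(1), of x], of cmod]
    by (simp only: norm_mult norm_one_minus_expo) simp
  also have "\<dots> \<le> real q * cmod (cantor_mask q x) * (2 * (pi * \<bar>x\<bar> / real q))"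
    using abs_sin_x_le_abs_x[of "pi * (x * (1 / real q))"]
    by (intro mult_left_mono) (auto simp: abs_mult)
  also have "\<dots> = 2 * (pi * \<bar>x\<bar> * cmod (cantor_mask q x))"
    using assms(1) by simp
  finally have "pi * \<bar>x\<bar> * (1 - \<bar>x\<bar>) \<le> pi * \<bar>x\<bar> * cmod (cantor_mask q x)"
    by simp
  moreover have "pi * \<bar>x\<bar> > 0" using False by simp
  ultimately show ?thesis by (simp only: mult_le_cancel_left_pos)
qed

text \<open>An exponential bound multiplies well along the product. For u >= 0, exp(-3u) <= 1 - u
  follows from (1 + 3u)(1 - u) >= 1, which holds up to u = 2/3; this is the origin of the 2/3 in all
  later lower bounds.\<close>

lemma norm_cantor_mask_ge_exp:
  assumes "q > 0" and "\<bar>x\<bar> \<le> 2 / 3"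
  shows "exp (- 3 * \<bar>x\<bar>) \<le> cmod (cantor_mask q x)"
proof -
  have "(1 + 3 * \<bar>x\<bar>) * (1 - \<bar>x\<bar>) = 1 + \<bar>x\<bar> * (2 - 3 * \<bar>x\<bar>)"
    by (simp add: algebra_simps)
  also have "\<dots> \<ge> 1" using assms(2) by (simp add: mult_nonneg_nonneg)
  finally have "1 \<le> (1 + 3 * \<bar>x\<bar>) * (1 - \<bar>x\<bar>)" .
  also have "\<dots> \<le> exp (3 * \<bar>x\<bar>) * (1 - \<bar>x\<bar>)"
    using assms(2) by (intro mult_right_mono exp_ge_add_one_self) auto
  finally have "exp (- 3 * \<bar>x\<bar>) \<le> 1 - \<bar>x\<bar>"
    by (simp add: exp_minus field_simps)
  also have "\<dots> \<le> cmod (cantor_mask q x)" using assms by (intro norm_cantor_mask_ge) auto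
  finally show ?thesis .
qed

text \<open>Two terms suffice: 1 and \<open>expo x (1 / real q)\<close> are distinct points of the
  unit circle, so their sum is shorter than 2, and the other q - 2 terms contribute at most 1
  each.\<close>

lemma norm_cantor_mask_less_1:
  assumes "q \<ge> 2" and "0 < x" and "x < 1"
  shows "cmod (cantor_mask q x) < 1"
proof -
  let ?w = "expo x (1 / real q)"
  have "?w \<noteq> 1"
  proof
    assume "?w = 1"
    then obtain k :: int where "x / real q = of_int k"
      by (auto simp: expo_eq_1_iff elim: Ints_cases)
    moreover have "0 < x / real q" "x / real q < 1" using assms by (auto simp: field_simps)
    ultimately show False by simp
  qed
  moreover have sq: "(Re ?w)\<^sup>2 + (Im ?w)\<^sup>2 = 1"
    by (metis cmod_power2 norm_expo one_power2)
  moreover have "Re ?w \<le> 1"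
    using complex_Re_le_cmod[of ?w] by simp
  ultimately have "Re ?w < 1"
    by (cases "Re ?w = 1") (auto simp: complex_eq_iff)
  have "(cmod (1 + ?w))\<^sup>2 = 2 + 2 * Re ?w"
    using sq by (simp add: cmod_power2) (simp add: power2_eq_square algebra_simps)
  also have "\<dots> < 2\<^sup>2" using \<open>Re ?w < 1\<close> by simp
  finally have 2: "cmod (1 + ?w) < 2"
    by (rule power2_less_imp_less) simp
  obtain p where p: "q = Suc (Suc p)" using assms(1) by (metis add_2_eq_Suc le_Suc_ex)
  have "(\<Sum>i<q. expo x (real i / real q)) = (1 + ?w) + (\<Sum>i<p. expo x (real (Suc (Suc i)) / real q))"
    unfolding p sum.lessThan_Suc_shift by simp
  also have "cmod \<dots> \<le> cmod (1 + ?w) + (\<Sum>i<p. 1)"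
    by (intro order.trans[OF norm_triangle_ineq] add_left_mono sum_norm_le) simp
  also have "\<dots> < real q" using 2 by (simp add: p)
  finally show ?thesis using assms(1) by (simp add: cantor_mask_def norm_divide)
qed

section \<open>The Cantor measure and its Fourier transform\<close>

lemma borel_measurable_cantor_map [measurable]: "cantor_map q b i \<in> borel_measurable borel"
  unfolding cantor_map_def by measurable

text \<open>Reduction modulo \<open>q\<close> makes the series converge for every stream, not just almost surely.\<close>

definition stream_sum :: "nat \<Rightarrow> nat \<Rightarrow> nat stream \<Rightarrow> real" where
  "stream_sum q b s = (\<Sum>k. real (s !! k mod q) / real q * (1 / real b) ^ k)"

lemma
  assumes "q > 0" and "b \<ge> 2"
  shows summable_stream_sum: "summable (\<lambda>k. real (s !! k mod q) / real q * (1 / real b) ^ k)"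
    and stream_sum_nonneg: "0 \<le> stream_sum q b s"
    and stream_sum_le_2: "stream_sum q b s \<le> 2"
proof -
  have *: "norm (real (s !! k mod q) / real q * (1 / real b) ^ k) \<le> (1 / 2) ^ k" for k
  proof -
    have "s !! k mod q < q" using assms by simp
    then have "real (s !! k mod q) / real q \<le> 1" by simp
    moreover have "(1 / real b) ^ k \<le> (1 / 2) ^ k"
      using assms by (intro power_mono) (auto simp: field_simps)
    ultimately show ?thesis
      using mult_mono[of "real (s !! k mod q) / real q" 1 "(1 / real b) ^ k" "(1 / 2) ^ k"] by simp
  qed
  show summ: "summable (\<lambda>k. real (s !! k mod q) / real q * (1 / real b) ^ k)"
    by (rule summable_comparison_test'[of "\<lambda>k. (1 / 2) ^ k" 0]) (use * in auto)
  show "0 \<le> stream_sum q b s"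
    unfolding stream_sum_def by (intro suminf_nonneg summ) simp
  have "stream_sum q b s \<le> (\<Sum>k. (1 / 2) ^ k)"
    unfolding stream_sum_def using * by (intro suminf_le summ) (auto simp: abs_le_iff)
  also have "\<dots> = 2" by (subst suminf_geometric) auto
  finally show "stream_sum q b s \<le> 2" .
qed

lemma stream_sum_Stream:
  assumes "q > 0" and "b \<ge> 2" and "i < q"
  shows "stream_sum q b (i ## s) = cantor_map q b i (stream_sum q b s)"
proof -
  have "stream_sum q b (i ## s) = (\<Sum>k. real ((i ## s) !! Suc k mod q) / real q * (1 / real b) ^ Suc k)
      + real (i mod q) / real q"
    unfolding stream_sum_def
    by (subst suminf_split_head[OF summable_stream_sum[OF assms(1,2)]]) simp
  also have "(\<Sum>k. real ((i ## s) !! Suc k mod q) / real q * (1 / real b) ^ Suc k)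
      = (\<Sum>k. (1 / real b) * (real (s !! k mod q) / real q * (1 / real b) ^ k))"
    by (simp add: mult_ac)
  also have "\<dots> = (1 / real b) * stream_sum q b s"
    unfolding stream_sum_def by (rule suminf_mult) (rule summable_stream_sum[OF assms(1,2)])
  finally show ?thesis using assms(3) by (simp add: cantor_map_def)
qed

text \<open>The law of the random series with independent uniform digits; splitting off the first
  digit is the self-similarity. The crude interval supplies the compact set for the
  Stone-Weierstrass approximation.\<close>

lemma ex_cantor_measure:
  assumes "q > 0" and "b \<ge> 2"
  obtains M where "is_cantor_measure q b M" and "AE x in M. x \<in> {0..2}"
proof -
  define U where "U = measure_pmf (pmf_of_set {..<q})"
  interpret U: prob_space U unfolding U_def by (rule measure_pmf.prob_space_axioms)
  define S where "S = stream_space U"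
  interpret S: prob_space S unfolding S_def by (rule U.prob_space_stream_space)
  have [measurable]: "(\<lambda>s. s !! k) \<in> measurable S (count_space UNIV)" for k
    using measurable_snth[of k U] unfolding S_def U_def by simp
  have X [measurable]: "stream_sum q b \<in> borel_measurable S"
    unfolding stream_sum_def by measurable
  define M where "M = distr S borel (stream_sum q b)"
  interpret M: prob_space M unfolding M_def by (rule S.prob_space_distr) simp
  have em: "emeasure M A = (\<Sum>i<q. emeasure M (cantor_map q b i -` A)) / of_nat q"
    if [measurable]: "A \<in> sets borel" for A
  proof -
    have pre [measurable]: "cantor_map q b i -` A \<in> sets borel" for i
      using measurable_sets[OF borel_measurable_cantor_map that] by simp
    have sp: "space S = UNIV" by (simp add: S_def U_def space_stream_space)
    have "emeasure M A = emeasure S (stream_sum q b -` A)"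
      unfolding M_def by (subst emeasure_distr) (auto simp: sp)
    also have "\<dots> = (\<integral>\<^sup>+i. emeasure S {s \<in> space S. i ## s \<in> stream_sum q b -` A} \<partial>U)"
      unfolding S_def using measurable_sets[OF X that] sp
      by (intro U.emeasure_stream_space) (simp add: S_def)
    also have "\<dots> = (\<Sum>i<q. emeasure S {s \<in> space S. i ## s \<in> stream_sum q b -` A}) / of_nat q"
      unfolding U_def using assms by (subst nn_integral_pmf_of_set) auto
    also have "(\<Sum>i<q. emeasure S {s \<in> space S. i ## s \<in> stream_sum q b -` A})
        = (\<Sum>i<q. emeasure M (cantor_map q b i -` A))"
    proof (rule sum.cong[OF refl])
      fix i assume "i \<in> {..<q}"
      then have "{s \<in> space S. i ## s \<in> stream_sum q b -` A}
          = stream_sum q b -` (cantor_map q b i -` A) \<inter> space S"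
        using assms by (auto simp: stream_sum_Stream)
      then show "emeasure S {s \<in> space S. i ## s \<in> stream_sum q b -` A}
          = emeasure M (cantor_map q b i -` A)"
        unfolding M_def by (simp add: emeasure_distr)
    qed
    finally show ?thesis .
  qed
  have "is_cantor_measure q b M"
    unfolding is_cantor_measure_def
  proof (intro conjI ballI)
    show "prob_space M" by (rule M.prob_space_axioms)
    show "sets M = sets borel" by (simp add: M_def)
    fix A :: "real set" assume A: "A \<in> sets borel"
    have "ennreal (measure M A) = (\<Sum>i<q. ennreal (measure M (cantor_map q b i -` A))) / of_nat q"
      using em[OF A] by (simp add: M.emeasure_eq_measure)
    also have "\<dots> = ennreal ((\<Sum>i<q. measure M (cantor_map q b i -` A)) / real q)"
      using assms(1) by (simp add: sum_ennreal divide_ennreal sum_nonneg ennreal_of_nat_eq_real_of_nat)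
    finally have "measure M A = (\<Sum>i<q. measure M (cantor_map q b i -` A)) / real q"
      by (subst (asm) ennreal_inj) (auto intro!: divide_nonneg_nonneg sum_nonneg)
    then show "measure M A = 1 / real q * (\<Sum>i<q. measure M (cantor_map q b i -` A))"
      by simp
  qed
  moreover have "AE x in M. x \<in> {0..2}"
    unfolding M_def using assms
    by (subst AE_distr_iff) (auto simp: stream_sum_nonneg stream_sum_le_2)
  ultimately show thesis using that by blast
qed

section \<open>The Fourier transform of any solution of the self-similarity equation\<close>

locale self_similar_measure = prob_space M for M :: "real measure" +
  fixes q b :: nat
  assumes q_pos: "q > 0" and b_ge_2: "b \<ge> 2"
    and is_cantor: "is_cantor_measure q b M"
begin

lemma sets_M [measurable_cong, simp]: "sets M = sets borel"
  using is_cantor by (simp add: is_cantor_measure_def)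

lemma space_M [simp]: "space M = UNIV"
  using sets_eq_imp_space_eq[OF sets_M] by simp

lemma real_distribution_M: "real_distribution M"
  by unfold_locales simp_all

text \<open>The hypothesis speaks of sets only. \<open>M\<close> is first recognised as the image of
  the product of the uniform law and \<open>M\<close> under \<open>cantor_map\<close>; integrals
  then follow by Fubini.\<close>

lemma integral_self_similar:
  fixes g :: "real \<Rightarrow> complex"
  assumes [measurable]: "g \<in> borel_measurable borel" and bound: "\<And>x. cmod (g x) \<le> B"
  shows "(\<integral>x. g x \<partial>M) = (\<Sum>i<q. \<integral>x. g (cantor_map q b i x) \<partial>M) / of_nat q"
proof -
  define U where "U = measure_pmf (pmf_of_set {..<q})"
  interpret U: prob_space U unfolding U_def by (rule measure_pmf.prob_space_axioms)
  interpret UM: pair_prob_space U M ..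
  have [measurable_cong]: "sets U = sets (count_space UNIV)" by (simp add: U_def)
  have F [measurable]: "(\<lambda>(i, x). cantor_map q b i x) \<in> borel_measurable (U \<Otimes>\<^sub>M M)"
    unfolding cantor_map_def by measurable
  have "M = distr (U \<Otimes>\<^sub>M M) borel (\<lambda>(i, x). cantor_map q b i x)"
  proof (rule measure_eqI)
    fix A assume "A \<in> sets M"
    then have [measurable]: "A \<in> sets borel" by simp
    have "emeasure (distr (U \<Otimes>\<^sub>M M) borel (\<lambda>(i, x). cantor_map q b i x)) A
        = emeasure (U \<Otimes>\<^sub>M M) ((\<lambda>(i, x). cantor_map q b i x) -` A \<inter> space (U \<Otimes>\<^sub>M M))"
      by (simp add: emeasure_distr)
    also have "\<dots> = (\<integral>\<^sup>+i. emeasure M (Pair i -` ((\<lambda>(i, x). cantor_map q b i x) -` A \<inter> space (U \<Otimes>\<^sub>M M))) \<partial>U)"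
      by (rule emeasure_pair_measure_alt) measurable
    also have "\<dots> = (\<integral>\<^sup>+i. emeasure M (cantor_map q b i -` A) \<partial>U)"
      by (intro nn_integral_cong arg_cong[where f = "emeasure M"]) (auto simp: space_pair_measure U_def)
    also have "\<dots> = (\<Sum>i<q. emeasure M (cantor_map q b i -` A)) / of_nat q"
      unfolding U_def using q_pos by (subst nn_integral_pmf_of_set) auto
    also have "\<dots> = ennreal ((\<Sum>i<q. measure M (cantor_map q b i -` A)) / real q)"
      using q_pos by (simp add: emeasure_eq_measure sum_ennreal divide_ennreal sum_nonneg ennreal_of_nat_eq_real_of_nat)
    also have "\<dots> = emeasure M A"
      using is_cantor by (simp add: is_cantor_measure_def emeasure_eq_measure)
    finally show "emeasure M A = emeasure (distr (U \<Otimes>\<^sub>M M) borel (\<lambda>(i, x). cantor_map q b i x)) A" ..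
  qed simp
  then have "(\<integral>x. g x \<partial>M) = (\<integral>p. g (case p of (i, x) \<Rightarrow> cantor_map q b i x) \<partial>(U \<Otimes>\<^sub>M M))"
    by (metis F assms(1) integral_distr)
  also have "\<dots> = (\<integral>i. \<integral>x. g (cantor_map q b i x) \<partial>M \<partial>U)"
  proof -
    have "integrable (U \<Otimes>\<^sub>M M) (\<lambda>p. g (case p of (i, x) \<Rightarrow> cantor_map q b i x))"
      by (rule UM.P.integrable_const_bound[where B = B]) (use bound in auto)
    from UM.integral_fst'[OF this] show ?thesis by simp
  qed
  also have "\<dots> = (\<Sum>i<q. \<integral>x. g (cantor_map q b i x) \<partial>M) / of_nat q"
    unfolding U_def using q_pos
    by (subst integral_measure_pmf[of "{..<q}"])
       (auto simp: scaleR_conv_of_real sum_divide_distrib lessThan_empty_iff intro!: sum.cong)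
  finally show ?thesis .
qed

definition mu_hat :: "real \<Rightarrow> complex" where
  "mu_hat t = (\<integral>x. expo t x \<partial>M)"

lemma integrable_expo [simp]: "integrable M (expo t)"
  by (rule integrable_const_bound[where B = 1]) auto

lemma mu_hat_rec: "mu_hat t = cantor_mask q t * mu_hat (t / real b)"
proof -
  have "mu_hat t = (\<Sum>i<q. \<integral>x. expo t (cantor_map q b i x) \<partial>M) / of_nat q"
    unfolding mu_hat_def by (rule integral_self_similar[where B = 1]) auto
  moreover have "expo t (cantor_map q b i x) = expo t (real i / real q) * expo (t / real b) x" for i x
    by (simp add: expo_cis cis_mult cantor_map_def algebra_simps)
  ultimately show ?thesis
    by (simp add: mu_hat_def cantor_mask_def sum_distrib_right)
qed

lemma mu_hat_conv_char: "mu_hat t = char M (- (2 * pi * t))"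
  unfolding mu_hat_def char_def expo_cis cis_conv_exp by (simp add: mult_ac)

lemma isCont_mu_hat: "isCont mu_hat t"
proof -
  interpret real_distribution M by (rule real_distribution_M)
  show ?thesis unfolding mu_hat_conv_char[abs_def]
    by (intro continuous_intros isCont_o2[OF _ isCont_char])
qed

lemma mu_hat_0: "mu_hat 0 = 1"
  using prob_space by (simp add: mu_hat_def)

lemma mu_hat_minus: "mu_hat (- t) = cnj (mu_hat t)"
  by (simp add: mu_hat_def cnj_expo[symmetric])

lemma norm_mu_hat_minus: "cmod (mu_hat (- t)) = cmod (mu_hat t)"
  by (simp add: mu_hat_minus)

lemma L2_inner_expo: "L2_inner M (expo l) (expo l') = mu_hat (l - l')"
  by (simp add: L2_inner_def expo_mult_cnj mu_hat_def)

lemma div_power_tendsto_0: "(\<lambda>n. t / real b ^ n) \<longlonglongrightarrow> 0"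
  using LIMSEQ_divide_realpow_zero[of "real b" t] b_ge_2 by simp

lemma mu_hat_div_power_tendsto: "(\<lambda>n. mu_hat (t / real b ^ n)) \<longlonglongrightarrow> 1"
  using isCont_tendsto_compose[OF isCont_mu_hat div_power_tendsto_0] by (simp add: mu_hat_0)

lemma mu_hat_prod: "mu_hat t = (\<Prod>j<n. cantor_mask q (t / real b ^ j)) * mu_hat (t / real b ^ n)"
proof (induction n)
  case (Suc n)
  then show ?case using mu_hat_rec[of "t / real b ^ n"] by (simp add: mult_ac)
qed simp

text \<open>The leftover factor in \<open>mu_hat_prod\<close> tends to 1, so the transform depends
  on q and b alone; uniqueness of the measure rests on this.\<close>

lemma prod_mask_tendsto: "(\<lambda>n. \<Prod>j<n. cantor_mask q (t / real b ^ j)) \<longlonglongrightarrow> mu_hat t"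
proof -
  have "(\<lambda>n. mu_hat t / mu_hat (t / real b ^ n)) \<longlonglongrightarrow> mu_hat t / 1"
    by (intro tendsto_divide tendsto_const mu_hat_div_power_tendsto) simp
  moreover have "eventually (\<lambda>n. mu_hat (t / real b ^ n) \<noteq> 0) sequentially"
    using tendsto_imp_eventually_ne[OF mu_hat_div_power_tendsto, of 0] by simp
  then have "eventually (\<lambda>n. mu_hat t / mu_hat (t / real b ^ n) = (\<Prod>j<n. cantor_mask q (t / real b ^ j))) sequentially"
  proof eventually_elim
    case (elim n)
    then show ?case using mu_hat_prod[of t n] by simp
  qed
  ultimately show ?thesis by (simp add: Lim_transform_eventually)
qed

text \<open>Some tail \<open>mu_hat (t / real b ^ n)\<close> is nonzero, so a zero of the transform
  is a zero of one of finitely many mask factors.\<close>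

lemma mu_hat_eq_0_iff:
  "mu_hat t = 0 \<longleftrightarrow> (\<exists>j k. t = real b ^ j * of_int k \<and> \<not> int q dvd k)"
proof -
  have b: "real b ^ j \<noteq> 0" for j using b_ge_2 by simp
  have "mu_hat t = 0 \<longleftrightarrow> (\<exists>j. cantor_mask q (t / real b ^ j) = 0)"
  proof
    assume 0: "mu_hat t = 0"
    obtain n where "mu_hat (t / real b ^ n) \<noteq> 0"
      using eventually_happens'[OF sequentially_bot tendsto_imp_eventually_ne[OF mu_hat_div_power_tendsto, of 0]]
      by auto
    then show "\<exists>j. cantor_mask q (t / real b ^ j) = 0"
      using mu_hat_prod[of t n] 0 by auto
  next
    assume "\<exists>j. cantor_mask q (t / real b ^ j) = 0"
    then obtain j where "cantor_mask q (t / real b ^ j) = 0" ..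
    then show "mu_hat t = 0" by (subst mu_hat_prod[of t "Suc j"]) simp
  qed
  also have "\<dots> \<longleftrightarrow> (\<exists>j k. t = real b ^ j * of_int k \<and> \<not> int q dvd k)"
    unfolding cantor_mask_eq_0_iff[OF q_pos] using b by (simp add: field_simps)
  finally show ?thesis .
qed

end

lemma is_cantor_measure_unique:
  assumes "q > 0" and "b \<ge> 2" and "is_cantor_measure q b M" and "is_cantor_measure q b N"
  shows "M = N"
proof -
  interpret M: self_similar_measure M q b
    using assms by (auto simp: self_similar_measure_def self_similar_measure_axioms_def is_cantor_measure_def)
  interpret N: self_similar_measure N q b
    using assms by (auto simp: self_similar_measure_def self_similar_measure_axioms_def is_cantor_measure_def)
  have "char M t = char N t" for t
    \<comment> \<open>This argument translates between the factor -2 pi in \<open>expo\<close> and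
      the convention of \<open>char\<close>.\<close>
    using LIMSEQ_unique[OF M.prod_mask_tendsto N.prod_mask_tendsto, of "- t / (2 * pi)"]
    by (simp add: M.mu_hat_conv_char N.mu_hat_conv_char)
  then show ?thesis
    by (intro Levy_uniqueness M.real_distribution_M N.real_distribution_M) auto
qed

lemma
  assumes "q > 0" and "b \<ge> 2"
  shows self_similar_cantor_measure: "self_similar_measure (cantor_measure q b) q b"
    and cantor_measure_AE: "AE x in cantor_measure q b. x \<in> {0..2}"
proof -
  obtain M where M: "is_cantor_measure q b M" "AE x in M. x \<in> {0..2}"
    using ex_cantor_measure[OF assms] .
  have "cantor_measure q b = M"
    unfolding cantor_measure_def
    using M(1) is_cantor_measure_unique[OF assms _ M(1)] by (rule the_equality)
  with M assms show "self_similar_measure (cantor_measure q b) q b" "AE x in cantor_measure q b. x \<in> {0..2}"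
    by (auto simp: self_similar_measure_def self_similar_measure_axioms_def is_cantor_measure_def)
qed

section \<open>Trees of integers and Bessel sums\<close>

text \<open>No digit expansion is assumed: a letter in position n leaves the integer fixed modulo
  b^n and separates siblings modulo q b^n. These conditions survive exact division by a number
  coprime to b, so both sets of the theorem are instances.\<close>

locale residue_tree = self_similar_measure M q b for M q b +
  fixes L :: "nat list \<Rightarrow> int"
  assumes q_dvd_b: "q dvd b"
    and L_append_zero: "\<And>w. set w \<subseteq> {..<q} \<Longrightarrow> L (w @ [0]) = L w"
    and L_append_cong: "\<And>w i. set w \<subseteq> {..<q} \<Longrightarrow> i < q \<Longrightarrow> int b ^ length w dvd L (w @ [i]) - L w"
    and L_append_inj: "\<And>w i j. set w \<subseteq> {..<q} \<Longrightarrow> i < q \<Longrightarrow> j < q \<Longrightarrow>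
      int b ^ length w * int q dvd L (w @ [i]) - L (w @ [j]) \<Longrightarrow> i = j"
begin

definition level :: "nat \<Rightarrow> nat list set" where
  "level n = {w. set w \<subseteq> {..<q} \<and> length w = n}"

definition power_spectrum :: "real \<Rightarrow> real" where
  "power_spectrum x = (cmod (mu_hat x))\<^sup>2"

definition partial_spectrum :: "nat \<Rightarrow> real \<Rightarrow> real" where
  "partial_spectrum n x = (\<Prod>j<n. (cmod (cantor_mask q (x / real b ^ j)))\<^sup>2)"

definition bessel_sum :: "nat \<Rightarrow> real \<Rightarrow> real" where
  "bessel_sum n x = (\<Sum>w\<in>level n. power_spectrum (x + of_int (L w)))"

lemma level_0: "level 0 = {[]}"
  by (auto simp: level_def)

lemma finite_level [simp]: "finite (level n)"
  by (simp add: level_def finite_lists_length_eq)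

lemma sum_level_Suc: "sum f (level (Suc n)) = (\<Sum>w\<in>level n. \<Sum>i<q. f (w @ [i]))"
proof -
  have "level (Suc n) = (\<lambda>(w, i). w @ [i]) ` (level n \<times> {..<q})"
  proof (intro equalityI subsetI)
    fix w assume "w \<in> level (Suc n)"
    then have "w = butlast w @ [last w]" "set w \<subseteq> {..<q}" "length (butlast w) = n"
      by (auto simp: level_def length_Suc_conv_rev)
    then have "w = (\<lambda>(w, i). w @ [i]) (butlast w, last w)" "(butlast w, last w) \<in> level n \<times> {..<q}"
      by (auto simp: level_def dest: in_set_butlastD) (metis Un_iff insert_iff lessThan_iff list.set(2) set_append subsetD)
    then show "w \<in> (\<lambda>(w, i). w @ [i]) ` (level n \<times> {..<q})" by blast
  qed (auto simp: level_def)
  moreover have "inj_on (\<lambda>(w, i). w @ [i]) (level n \<times> {..<q})"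
    by (auto simp: inj_on_def)
  ultimately have "sum f (level (Suc n)) = (\<Sum>(w, i)\<in>level n \<times> {..<q}. f (w @ [i]))"
    by (simp add: sum.reindex case_prod_unfold)
  then show ?thesis by (simp add: sum.cartesian_product)
qed

lemma power_spectrum_nonneg [simp]: "0 \<le> power_spectrum x"
  by (simp add: power_spectrum_def)

lemma partial_spectrum_nonneg [simp]: "0 \<le> partial_spectrum n x"
  by (simp add: partial_spectrum_def prod_nonneg)

lemma partial_spectrum_le_1: "partial_spectrum n x \<le> 1"
  unfolding partial_spectrum_def by (intro prod_le_1) (simp add: norm_cantor_mask_le_1 power_le_one)

lemma power_spectrum_le_1: "power_spectrum x \<le> 1"
proof -
  have "cmod (mu_hat x) \<le> 1"
    using integral_norm_bound[of M "expo x"] prob_space by (simp add: mu_hat_def)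
  then show ?thesis by (simp add: power_spectrum_def power_le_one)
qed

lemma power_spectrum_eq:
  "power_spectrum x = partial_spectrum n x * power_spectrum (x / real b ^ n)"
  unfolding power_spectrum_def partial_spectrum_def
  by (subst mu_hat_prod[of x n]) (simp add: norm_mult prod_norm[symmetric] power_mult_distrib prod_power_distrib)

lemma power_spectrum_le_partial: "power_spectrum x \<le> partial_spectrum n x"
  using power_spectrum_eq[of x n] power_spectrum_le_1 by (simp add: mult_left_le)

lemma partial_spectrum_tendsto: "(\<lambda>n. partial_spectrum n x) \<longlonglongrightarrow> power_spectrum x"
proof -
  have "partial_spectrum n x = (cmod (\<Prod>j<n. cantor_mask q (x / real b ^ j)))\<^sup>2" for n
    by (simp add: partial_spectrum_def prod_norm[symmetric] prod_power_distrib)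
  then show ?thesis
    unfolding power_spectrum_def by (auto intro!: tendsto_intros prod_mask_tendsto)
qed

text \<open>For j < n the number k / b^j is still a multiple of b, hence of the period q of the
  mask.\<close>

lemma partial_spectrum_cong:
  assumes "int b ^ n dvd k"
  shows "partial_spectrum n (x + of_int k) = partial_spectrum n x"
  unfolding partial_spectrum_def
proof (intro prod.cong refl)
  fix j assume "j \<in> {..<n}"
  obtain r where r: "k = int b ^ n * r" using assms by blast
  obtain p where p: "b = q * p" using q_dvd_b by blast
  have "n = j + Suc (n - Suc j)" using \<open>j \<in> {..<n}\<close> by simp
  then have "real b ^ n = real b ^ j * (real b * real b ^ (n - Suc j))"
    by (metis power_Suc power_add)
  then have "real_of_int k = real b ^ j * (real b * real b ^ (n - Suc j) * of_int r)"
    by (simp add: r)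
  then have "real_of_int k / real b ^ j = real b * real b ^ (n - Suc j) * of_int r"
    using b_ge_2 by simp
  moreover have "real b = real q * real p" by (simp add: p)
  ultimately have "real_of_int k / real b ^ j = real q * of_int (int p * int b ^ (n - Suc j) * r)"
    by simp
  then have "(x + of_int k) / real b ^ j = x / real b ^ j + real q * of_int (int p * int b ^ (n - Suc j) * r)"
    by (simp only: add_divide_distrib)
  then show "(cmod (cantor_mask q ((x + of_int k) / real b ^ j)))\<^sup>2 = (cmod (cantor_mask q (x / real b ^ j)))\<^sup>2"
    by (simp only: cantor_mask_periodic[OF q_pos])
qed

text \<open>The first n factors do not see the last letter, and the squares of the next factor sum
  to 1 over the q siblings.\<close>

lemma sum_partial_spectrum: "(\<Sum>w\<in>level n. partial_spectrum n (x + of_int (L w))) = 1"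
proof (induction n)
  case 0
  then show ?case by (simp add: level_0 partial_spectrum_def)
next
  case (Suc n)
  have "(\<Sum>i<q. partial_spectrum (Suc n) (x + of_int (L (w @ [i])))) = partial_spectrum n (x + of_int (L w))"
    if w: "w \<in> level n" for w
  proof -
    define d where "d i = (L (w @ [i]) - L w) div int b ^ n" for i
    have w': "set w \<subseteq> {..<q}" "length w = n" using w by (auto simp: level_def)
    have d: "L (w @ [i]) = L w + int b ^ n * d i" if "i < q" for i
      using L_append_cong[OF w'(1) that] w'(2) by (simp add: d_def)
    have "partial_spectrum (Suc n) (x + of_int (L (w @ [i])))
        = partial_spectrum n (x + of_int (L w)) * (cmod (cantor_mask q ((x + of_int (L w)) / real b ^ n + of_int (d i))))\<^sup>2"
      if "i < q" for i
    proof -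
      have *: "x + of_int (L (w @ [i])) = (x + of_int (L w)) + of_int (int b ^ n * d i)"
        using d[OF that] by simp
      have "(x + of_int (L (w @ [i]))) / real b ^ n = (x + of_int (L w)) / real b ^ n + of_int (d i)"
        unfolding * using b_ge_2 by (simp add: field_simps)
      moreover have "partial_spectrum n (x + of_int (L (w @ [i]))) = partial_spectrum n (x + of_int (L w))"
        unfolding * by (rule partial_spectrum_cong) simp
      ultimately show ?thesis by (simp add: partial_spectrum_def)
    qed
    then have "(\<Sum>i<q. partial_spectrum (Suc n) (x + of_int (L (w @ [i]))))
       = partial_spectrum n (x + of_int (L w)) * (\<Sum>i<q. (cmod (cantor_mask q ((x + of_int (L w)) / real b ^ n + of_int (d i))))\<^sup>2)"
      by (simp add: sum_distrib_left)
    also have "(\<Sum>i<q. (cmod (cantor_mask q ((x + of_int (L w)) / real b ^ n + of_int (d i))))\<^sup>2) = 1"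
    proof (rule sum_norm_cantor_mask[OF q_pos])
      fix i j assume ij: "i < q" "j < q" "int q dvd d i - d j"
      have "L (w @ [i]) - L (w @ [j]) = int b ^ n * (d i - d j)"
        using d ij by (simp add: algebra_simps)
      then have "int b ^ length w * int q dvd L (w @ [i]) - L (w @ [j])"
        using ij(3) w'(2) by simp
      then show "i = j" using L_append_inj[OF w'(1) ij(1,2)] by simp
    qed
    finally show ?thesis by simp
  qed
  then show ?case using Suc by (simp add: sum_level_Suc)
qed

lemma L_append_zeros: "set w \<subseteq> {..<q} \<Longrightarrow> L (w @ replicate k 0) = L w"
proof (induction k)
  case (Suc k)
  then have "set (w @ replicate k 0) \<subseteq> {..<q}" using q_pos by auto
  then have "L ((w @ replicate k 0) @ [0]) = L (w @ replicate k 0)" by (rule L_append_zero)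
  moreover have "w @ replicate (Suc k) 0 = (w @ replicate k 0) @ [0]"
    by (simp add: replicate_append_same)
  ultimately show ?case using Suc by simp
qed simp

text \<open>Padding with zeros embeds level n in level m with the same integers; these are the
  genuinely new words, for m = n + 1 those with nonzero last letter.\<close>

definition fresh :: "nat \<Rightarrow> nat \<Rightarrow> nat list set" where
  "fresh n m = level m - (\<lambda>w. w @ replicate (m - n) 0) ` level n"

lemma sum_level_fresh:
  assumes "n \<le> m"
  shows "(\<Sum>w\<in>level m. f (L w)) = (\<Sum>w\<in>level n. f (L w)) + (\<Sum>w\<in>fresh n m. (f (L w) :: real))"
proof -
  let ?p = "\<lambda>w. w @ replicate (m - n) (0::nat)"
  have sub: "?p ` level n \<subseteq> level m"
    using assms q_pos by (auto simp: level_def)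
  have "(\<Sum>w\<in>?p ` level n. f (L w)) = (\<Sum>w\<in>level n. f (L w))"
    by (subst sum.reindex) (auto simp: inj_on_def level_def L_append_zeros intro!: sum.cong)
  moreover have "(\<Sum>w\<in>level m. f (L w)) = (\<Sum>w\<in>fresh n m. f (L w)) + (\<Sum>w\<in>?p ` level n. f (L w))"
    unfolding fresh_def by (rule sum.subset_diff[OF sub]) simp
  ultimately show ?thesis by simp
qed

lemma last_fresh_Suc: "w \<in> fresh n (Suc n) \<Longrightarrow> w \<in> level (Suc n) \<and> last w \<noteq> 0"
proof (rule conjI)
  assume w: "w \<in> fresh n (Suc n)"
  then show "w \<in> level (Suc n)" by (simp add: fresh_def)
  then have "w \<noteq> []" "set (butlast w) \<subseteq> {..<q}" "length (butlast w) = n"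
    by (auto simp: level_def dest: in_set_butlastD)
  then have "butlast w @ [0] \<notin> fresh n (Suc n)"
    by (auto simp: fresh_def level_def)
  then have "w \<noteq> butlast w @ [0]" using w by auto
  then show "last w \<noteq> 0"
    using append_butlast_last_id[OF \<open>w \<noteq> []\<close>] by metis
qed

lemma bessel_sum_le_1: "bessel_sum n x \<le> 1"
proof -
  have "bessel_sum n x \<le> (\<Sum>w\<in>level n. partial_spectrum n (x + of_int (L w)))"
    unfolding bessel_sum_def by (intro sum_mono power_spectrum_le_partial)
  then show ?thesis by (simp add: sum_partial_spectrum)
qed

lemma bessel_sum_fresh:
  "n \<le> m \<Longrightarrow> bessel_sum m x = bessel_sum n x + (\<Sum>w\<in>fresh n m. power_spectrum (x + of_int (L w)))"
  unfolding bessel_sum_def by (rule sum_level_fresh)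

lemma incseq_bessel_sum: "incseq (\<lambda>n. bessel_sum n x)"
  by (rule incseq_SucI) (simp add: bessel_sum_fresh[OF le_SucI[OF order.refl]] sum_nonneg)

text \<open>Words of length \<open>n\<close> carry mass \<open>1\<close> at stage \<open>m\<close>, so by the lower bound the mass that they
  miss is at most \<open>1 / c\<close> times the increment of the Bessel sums between stages \<open>n\<close> and \<open>m\<close>.\<close>

lemma bessel_sum_tendsto_1:
  assumes "c > 0" and lower: "\<And>n w. n \<ge> n0 \<Longrightarrow> w \<in> level n \<Longrightarrow>
      c \<le> power_spectrum ((x + of_int (L w)) / real b ^ n)"
  shows "(\<lambda>n. bessel_sum n x) \<longlonglongrightarrow> 1"
proof -
  define l where "l = (SUP n. bessel_sum n x)"
  have bdd: "bdd_above (range (\<lambda>n. bessel_sum n x))"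
    using bessel_sum_le_1 by (auto simp: bdd_above_def)
  have lim: "(\<lambda>n. bessel_sum n x) \<longlonglongrightarrow> l"
    unfolding l_def by (rule LIMSEQ_incseq_SUP[OF bdd incseq_bessel_sum])
  have "c * (1 - (\<Sum>w\<in>level n. partial_spectrum m (x + of_int (L w)))) \<le> l - bessel_sum n x"
    if "n0 \<le> m" "n \<le> m" for n m
  proof -
    have "1 - (\<Sum>w\<in>level n. partial_spectrum m (x + of_int (L w)))
        = (\<Sum>w\<in>fresh n m. partial_spectrum m (x + of_int (L w)))"
      using sum_level_fresh[OF that(2), of "\<lambda>k. partial_spectrum m (x + of_int k)"]
      by (simp add: sum_partial_spectrum)
    also have "c * \<dots> \<le> (\<Sum>w\<in>fresh n m. power_spectrum (x + of_int (L w)))"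
      unfolding sum_distrib_left
    proof (rule sum_mono)
      fix w assume "w \<in> fresh n m"
      then have "c \<le> power_spectrum ((x + of_int (L w)) / real b ^ m)"
        using that by (intro lower) (auto simp: fresh_def)
      then have "partial_spectrum m (x + of_int (L w)) * c \<le> power_spectrum (x + of_int (L w))"
        by (subst power_spectrum_eq[of _ m]) (intro mult_left_mono partial_spectrum_nonneg)
      then show "c * partial_spectrum m (x + of_int (L w)) \<le> power_spectrum (x + of_int (L w))"
        by (simp add: mult.commute)
    qed
    also have "\<dots> = bessel_sum m x - bessel_sum n x"
      using bessel_sum_fresh[OF that(2)] by simp
    also have "\<dots> \<le> l - bessel_sum n x"
      using cSUP_upper[OF _ bdd, of m] by (simp add: l_def)
    finally show ?thesis .
  qed
  note step = this
  \<comment> \<open>First m tends to infinity for fixed n, then n does, so that the limit l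
    satisfies c (1 - l) <= 0.\<close>
  have "c * (1 - bessel_sum n x) \<le> l - bessel_sum n x" for n
  proof (rule LIMSEQ_le_const2)
    show "(\<lambda>m. c * (1 - (\<Sum>w\<in>level n. partial_spectrum m (x + of_int (L w))))) \<longlonglongrightarrow> c * (1 - bessel_sum n x)"
      unfolding bessel_sum_def by (intro tendsto_intros partial_spectrum_tendsto)
    show "\<exists>N. \<forall>m\<ge>N. c * (1 - (\<Sum>w\<in>level n. partial_spectrum m (x + of_int (L w)))) \<le> l - bessel_sum n x"
      using step by (intro exI[of _ "max n0 n"]) auto
  qed
  then have "c * (1 - l) \<le> l - l"
    by (intro LIMSEQ_le[of "\<lambda>n. c * (1 - bessel_sum n x)" _ "\<lambda>n. l - bessel_sum n x"] tendsto_intros lim) auto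
  then have "l \<ge> 1" using assms(1) by (simp add: mult_le_0_iff)
  moreover have "l \<le> 1" unfolding l_def by (rule cSUP_least) (auto simp: bessel_sum_le_1)
  ultimately show ?thesis using lim by simp
qed

text \<open>The defect \<open>D n\<close> shrinks at most by the factor \<open>1 - r\<^sup>n\<^sup>+\<^sup>1\<close> from stage \<open>n\<close> to \<open>n + 1\<close>, and the
  product of these factors is positive.\<close>

lemma bessel_sum_bounded_below_1:
  assumes r: "0 \<le> r" "r < 1"
    and upper: "\<And>n w. w \<in> level (Suc n) \<Longrightarrow> last w \<noteq> 0 \<Longrightarrow>
      power_spectrum ((x + of_int (L w)) / real b ^ Suc n) \<le> r ^ Suc n"
    and start: "bessel_sum 0 x < 1"
  obtains d where "d > 0" and "\<And>n. bessel_sum n x \<le> 1 - d"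
proof -
  define D where "D n = 1 - bessel_sum n x" for n
  have step: "(1 - r ^ Suc n) * D n \<le> D (Suc n)" for n
  proof -
    have "D n - D (Suc n) = (\<Sum>w\<in>fresh n (Suc n). power_spectrum (x + of_int (L w)))"
      using bessel_sum_fresh[of n "Suc n" x] by (simp add: D_def)
    also have "\<dots> \<le> (\<Sum>w\<in>fresh n (Suc n). r ^ Suc n * partial_spectrum (Suc n) (x + of_int (L w)))"
    proof (rule sum_mono)
      fix w assume "w \<in> fresh n (Suc n)"
      then have "power_spectrum ((x + of_int (L w)) / real b ^ Suc n) \<le> r ^ Suc n"
        using last_fresh_Suc upper by blast
      then show "power_spectrum (x + of_int (L w)) \<le> r ^ Suc n * partial_spectrum (Suc n) (x + of_int (L w))"
        by (subst power_spectrum_eq[of _ "Suc n"], subst mult.commute, intro mult_right_mono) auto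
    qed
    \<comment> \<open>The stage n + 1 masses sum to 1 over level n + 1, so the fresh words carry
      what the padded words of level n leave over, and that is at most \<open>D n\<close>.\<close>
    also have "\<dots> = r ^ Suc n * (1 - (\<Sum>w\<in>level n. partial_spectrum (Suc n) (x + of_int (L w))))"
      using sum_level_fresh[of n "Suc n" "\<lambda>k. partial_spectrum (Suc n) (x + of_int k)"]
      by (simp add: sum_partial_spectrum sum_distrib_left[symmetric])
    also have "\<dots> \<le> r ^ Suc n * D n"
      unfolding D_def bessel_sum_def using r(1)
      by (intro mult_left_mono diff_left_mono sum_mono power_spectrum_le_partial) auto
    finally show ?thesis by (simp add: algebra_simps)
  qed
  \<comment> \<open>Bounding 1 - t below by exp(-t / (1 - r)) on [0, r] turns the product of the
    factors into a geometric series in the exponent.\<close>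
  have exp_le: "exp (- (r ^ Suc n) / (1 - r)) \<le> 1 - r ^ Suc n" for n
  proof -
    define t where "t = r ^ Suc n"
    have t: "0 \<le> t" "t \<le> r"
      using r power_le_one[of r n] by (auto simp: t_def mult_left_le)
    have "1 / (1 - t) = 1 + t / (1 - t)" using t r by (simp add: field_simps)
    also have "\<dots> \<le> 1 + t / (1 - r)" using t r by (intro add_left_mono divide_left_mono) auto
    also have "\<dots> \<le> exp (t / (1 - r))" by (rule exp_ge_add_one_self)
    finally have "exp (- (t / (1 - r))) \<le> 1 - t"
      using t r by (simp add: exp_minus field_simps)
    then show ?thesis by (simp add: t_def)
  qed
  have "D 0 * exp (- (\<Sum>k<n. r ^ Suc k) / (1 - r)) \<le> D n" for n
  proof (induction n)
    case (Suc n)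
    have "D 0 * exp (- (\<Sum>k<Suc n. r ^ Suc k) / (1 - r))
        = (D 0 * exp (- (\<Sum>k<n. r ^ Suc k) / (1 - r))) * exp (- (r ^ Suc n) / (1 - r))"
      by (simp add: exp_add[symmetric] add_divide_distrib diff_divide_distrib del: power_Suc)
    also have "\<dots> \<le> D n * (1 - r ^ Suc n)"
      using Suc exp_le start bessel_sum_le_1[of n x]
      by (intro mult_mono) (auto simp: D_def simp del: power_Suc)
    also have "\<dots> \<le> D (Suc n)" using step by (simp add: mult.commute)
    finally show ?case .
  qed simp
  moreover have "exp (- (1 / (1 - r)) / (1 - r)) \<le> exp (- (\<Sum>k<n. r ^ Suc k) / (1 - r))" for n
  proof -
    have "(\<Sum>k<n. r ^ Suc k) \<le> (\<Sum>k. r ^ k)"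
    proof -
      have "(\<Sum>k<n. r ^ Suc k) \<le> (\<Sum>k<n. r ^ k)"
        using r by (intro sum_mono) (simp add: mult_left_le_one_le)
      also have "\<dots> \<le> (\<Sum>k. r ^ k)"
        using r by (intro sum_le_suminf summable_geometric) auto
      finally show ?thesis .
    qed
    also have "\<dots> = 1 / (1 - r)" using r by (intro suminf_geometric) simp
    finally have "- (1 / (1 - r)) / (1 - r) \<le> - (\<Sum>k<n. r ^ Suc k) / (1 - r)"
      using r by (intro divide_right_mono) auto
    then show ?thesis by (simp only: exp_le_cancel_iff)
  qed
  ultimately have "D 0 * exp (- (1 / (1 - r)) / (1 - r)) \<le> D n" for n
    using start by (smt (verit) D_def mult_left_mono)
  moreover have "D 0 * exp (- (1 / (1 - r)) / (1 - r)) > 0"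
    using start by (simp add: D_def)
  ultimately show thesis using that by (auto simp: D_def) (smt (verit))
qed

text \<open>Decided at the first position j in which the words differ: \<open>L_append_inj\<close>
  keeps q from dividing the quotient there, and the letters behind it only add multiples of b, hence
  of q.\<close>

lemma L_diff:
  assumes "w \<in> level n" and "w' \<in> level n" and "w \<noteq> w'"
  obtains j k where "j < n" and "L w - L w' = int b ^ j * k" and "\<not> int q dvd k"
proof -
  have "\<exists>j<n. \<exists>k. L w - L w' = int b ^ j * k \<and> \<not> int q dvd k"
    using assms
  proof (induction n arbitrary: w w')
    case (Suc n)
    obtain v i where v: "w = v @ [i]" "v \<in> level n" "i < q"
      using Suc.prems(1) by (cases w rule: rev_cases) (auto simp: level_def)
    obtain v' i' where v': "w' = v' @ [i']" "v' \<in> level n" "i' < q"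
      using Suc.prems(2) by (cases w' rule: rev_cases) (auto simp: level_def)
    have lv: "set v \<subseteq> {..<q}" "length v = n" "set v' \<subseteq> {..<q}" "length v' = n"
      using v v' by (auto simp: level_def)
    obtain s where s: "L w = L v + int b ^ n * s"
      using L_append_cong[OF lv(1) v(3)] lv v(1) by (metis add.commute diff_add_cancel dvdE)
    obtain s' where s': "L w' = L v' + int b ^ n * s'"
      using L_append_cong[OF lv(3) v'(3)] lv v'(1) by (metis add.commute diff_add_cancel dvdE)
    show ?case
    proof (cases "v = v'")
      case True
      have "L w - L w' = int b ^ n * (s - s')" using s s' True by (simp add: algebra_simps)
      moreover have "\<not> int q dvd s - s'"
      proof
        assume "int q dvd s - s'"
        then have "int b ^ length v * int q dvd L (v @ [i]) - L (v @ [i'])"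
          using calculation v(1) v'(1) True lv by simp
        then show False using L_append_inj[OF lv(1) v(3) v'(3)] Suc.prems(3) v(1) v'(1) True by simp
      qed
      ultimately show ?thesis by blast
    next
      case False
      with Suc.IH[OF v(2) v'(2)] obtain j k where jk: "j < n" "L v - L v' = int b ^ j * k" "\<not> int q dvd k"
        by blast
      have "n = j + Suc (n - Suc j)" using jk(1) by simp
      then have e: "int b ^ n = int b ^ j * (int b * int b ^ (n - Suc j))"
        by (metis power_Suc power_add)
      have "L w - L w' = int b ^ j * (k + int b * (int b ^ (n - Suc j) * (s - s')))"
        unfolding s s' using jk(2) e by (simp add: algebra_simps)
      moreover have "\<not> int q dvd k + int b * (int b ^ (n - Suc j) * (s - s'))"
        using jk(3) q_dvd_b by (simp add: dvd_add_left_iff)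
      ultimately show ?thesis using jk(1) less_SucI by blast
    qed
  qed (simp add: level_0)
  then show thesis using that by blast
qed

lemma mu_hat_L_diff:
  assumes "w \<in> level n" and "w' \<in> level n" and "w \<noteq> w'"
  shows "mu_hat (of_int (L w) - of_int (L w')) = 0"
proof -
  obtain j k where "L w - L w' = int b ^ j * k" "\<not> int q dvd k"
    using L_diff[OF assms] by metis
  then have "of_int (L w) - of_int (L w') = real b ^ j * of_int k" "\<not> int q dvd k"
    by (metis of_int_diff of_int_mult of_int_of_nat_eq of_int_power)+
  then show ?thesis unfolding mu_hat_eq_0_iff by blast
qed

definition frequencies :: "real set" where
  "frequencies = (\<lambda>w. of_int (L w)) ` {w. set w \<subseteq> {..<q}}"

text \<open>Two words with the same integer would make \<open>mu_hat 0\<close> vanish.\<close>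

lemma inj_on_L_level: "inj_on (\<lambda>w. real_of_int (L w)) (level n)"
  using mu_hat_L_diff mu_hat_0 by (fastforce simp: inj_on_def)

lemma frequencies_level:
  assumes "finite F" and "F \<subseteq> frequencies"
  obtains n where "F \<subseteq> (\<lambda>w. of_int (L w)) ` level n"
proof -
  obtain W where W: "W \<subseteq> {w. set w \<subseteq> {..<q}}" "finite W" "F = (\<lambda>w. of_int (L w)) ` W"
    using finite_subset_image[OF assms(1) assms(2)[unfolded frequencies_def]] by auto
  \<comment> \<open>The 0 covers the empty set.\<close>
  define n where "n = Max (insert 0 (length ` W))"
  have "of_int (L w) \<in> (\<lambda>w. real_of_int (L w)) ` level n" if "w \<in> W" for w
  proof
    have "length w \<le> n" using that W(2) by (simp add: n_def)
    then show "w @ replicate (n - length w) 0 \<in> level n"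
      using that W(1) q_pos by (auto simp: level_def)
    show "real_of_int (L w) = real_of_int (L (w @ replicate (n - length w) 0))"
      using that W(1) by (auto simp: L_append_zeros)
  qed
  then show thesis using that W(3) by blast
qed

lemma level_subset_frequencies: "(\<lambda>w. of_int (L w)) ` level n \<subseteq> frequencies"
  by (auto simp: frequencies_def level_def)

lemma orthogonal_frequencies: "orthogonal_set M frequencies"
  unfolding orthogonal_set_def
proof
  show "countable frequencies" unfolding frequencies_def by simp
  show "pairwise (\<lambda>l l'. L2_inner M (expo l) (expo l') = 0) frequencies"
  proof (rule pairwiseI)
    fix l l' assume l: "l \<in> frequencies" "l' \<in> frequencies" "l \<noteq> l'"
    then obtain n where "{l, l'} \<subseteq> (\<lambda>w. of_int (L w)) ` level n"
      using frequencies_level[of "{l, l'}"] by auto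
    then show "L2_inner M (expo l) (expo l') = 0"
      using mu_hat_L_diff l(3) by (auto simp: L2_inner_expo)
  qed
qed

end

section \<open>Density of trigonometric polynomials\<close>

inductive_set trig_poly :: "(real \<Rightarrow> complex) set" where
  expo: "expo l \<in> trig_poly"
| add: "f \<in> trig_poly \<Longrightarrow> g \<in> trig_poly \<Longrightarrow> (\<lambda>x. f x + g x) \<in> trig_poly"
| scale: "f \<in> trig_poly \<Longrightarrow> (\<lambda>x. c * f x) \<in> trig_poly"

lemma trig_poly_const: "(\<lambda>x. c) \<in> trig_poly"
  using trig_poly.scale[OF trig_poly.expo[of 0], of c] by simp

lemma trig_poly_mult:
  assumes "f \<in> trig_poly" and "g \<in> trig_poly"
  shows "(\<lambda>x. f x * g x) \<in> trig_poly"
  using assms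
proof (induction f rule: trig_poly.induct)
  case (expo l)
  from expo.prems show ?case
  proof (induction g rule: trig_poly.induct)
    case (expo l')
    then show ?case using trig_poly.expo[of "l + l'"] by (simp add: expo_add_left[abs_def])
  next
    case (add f g)
    then show ?case using trig_poly.add by (simp add: distrib_left)
  next
    case (scale f c)
    then show ?case using trig_poly.scale[of _ c] by (simp add: mult.left_commute)
  qed
next
  case (add f g)
  then show ?case using trig_poly.add by (simp add: distrib_right)
next
  case (scale f c)
  then show ?case using trig_poly.scale[of _ c] by (simp add: mult.assoc)
qed

lemma trig_poly_cos: "(\<lambda>x. complex_of_real (cos (2 * pi * l * (x - y)))) \<in> trig_poly"
proof -
  have "(\<lambda>x. complex_of_real (cos (2 * pi * l * (x - y))))
      = (\<lambda>x. (expo (- l) y / 2) * expo l x + (expo l y / 2) * expo (- l) x)"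
    by (auto simp: fun_eq_iff expo_cis complex_eq_iff cos_diff sin_diff algebra_simps
        diff_divide_distrib)
  then show ?thesis by (simp only: trig_poly.intros)
qed

lemma trig_poly_continuous: "f \<in> trig_poly \<Longrightarrow> continuous_on S f"
  by (induction rule: trig_poly.induct) (auto intro!: continuous_intros continuous_expo_right)

lemma trig_poly_dense_continuous:
  fixes f :: "real \<Rightarrow> real"
  assumes "continuous_on {u..v} f" and "e > 0"
  obtains g where "(\<lambda>x. complex_of_real (g x)) \<in> trig_poly" and "\<And>x. x \<in> {u..v} \<Longrightarrow> \<bar>f x - g x\<bar> < e"
proof -
  interpret function_ring_on "{g. (\<lambda>x. complex_of_real (g x)) \<in> trig_poly}" "{u..v}"
  proof
    fix f :: "real \<Rightarrow> real" assume "f \<in> {g. (\<lambda>x. complex_of_real (g x)) \<in> trig_poly}"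
    then have "continuous_on {u..v} (\<lambda>x. Re (complex_of_real (f x)))"
      by (intro continuous_on_Re trig_poly_continuous) simp
    then show "continuous_on {u..v} f" by simp
  next
    fix x y :: real assume "x \<noteq> y"
    \<comment> \<open>The points x and y are half a period apart, so the values there are -1 and
      1.\<close>
    let ?g = "\<lambda>z. cos (2 * pi * (1 / (2 * (x - y))) * (z - y))"
    have "2 * pi * (1 / (2 * (x - y))) * (x - y) = pi" using \<open>x \<noteq> y\<close> by (simp add: divide_simps)
    then have "?g x = - 1" "?g y = 1" by simp_all
    moreover have "?g \<in> {g. (\<lambda>x. complex_of_real (g x)) \<in> trig_poly}"
      using trig_poly_cos by blast
    ultimately show "\<exists>f\<in>{g. (\<lambda>x. complex_of_real (g x)) \<in> trig_poly}. f x \<noteq> f y"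
      by (intro bexI[of _ ?g]) auto
  qed (auto simp: trig_poly.add trig_poly_mult trig_poly_const)
  show thesis using Stone_Weierstrass_basic[OF assms] that by auto
qed

definition expo_span :: "real set \<Rightarrow> (real \<Rightarrow> complex) set" where
  "expo_span L = {\<lambda>x. \<Sum>l\<in>F. c l * expo l x | F c. finite F \<and> F \<subseteq> L}"

lemma expo_span_add:
  assumes "f \<in> expo_span L" and "g \<in> expo_span L"
  shows "(\<lambda>x. f x + g x) \<in> expo_span L"
proof -
  obtain F c where F: "finite F" "F \<subseteq> L" "f = (\<lambda>x. \<Sum>l\<in>F. c l * expo l x)"
    using assms(1) by (auto simp: expo_span_def)
  obtain G d where G: "finite G" "G \<subseteq> L" "g = (\<lambda>x. \<Sum>l\<in>G. d l * expo l x)"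
    using assms(2) by (auto simp: expo_span_def)
  have "(\<lambda>x. f x + g x) = (\<lambda>x. \<Sum>l\<in>F \<union> G. ((if l \<in> F then c l else 0) + (if l \<in> G then d l else 0)) * expo l x)"
  proof
    fix x
    have "f x = (\<Sum>l\<in>F \<union> G. (if l \<in> F then c l else 0) * expo l x)"
      unfolding F(3) using F(1) G(1) by (intro sum.mono_neutral_cong_left) auto
    moreover have "g x = (\<Sum>l\<in>F \<union> G. (if l \<in> G then d l else 0) * expo l x)"
      unfolding G(3) using F(1) G(1) by (intro sum.mono_neutral_cong_left) auto
    ultimately show "f x + g x = (\<Sum>l\<in>F \<union> G. ((if l \<in> F then c l else 0) + (if l \<in> G then d l else 0)) * expo l x)"
      by (simp add: distrib_right sum.distrib)
  qed
  then show ?thesis using F(1,2) G(1,2) unfolding expo_span_def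
    by (intro CollectI exI[of _ "F \<union> G"] exI) auto
qed

lemma expo_span_scale:
  assumes "f \<in> expo_span L"
  shows "(\<lambda>x. a * f x) \<in> expo_span L"
proof -
  obtain F c where F: "finite F" "F \<subseteq> L" "f = (\<lambda>x. \<Sum>l\<in>F. c l * expo l x)"
    using assms by (auto simp: expo_span_def)
  have eq: "(\<lambda>x. a * f x) = (\<lambda>x. \<Sum>l\<in>F. (a * c l) * expo l x)"
    by (simp add: F(3) sum_distrib_left mult.assoc)
  show ?thesis unfolding eq expo_span_def using F(1,2)
    by (intro CollectI exI[of _ F] exI[of _ "\<lambda>l. a * c l"] conjI refl)
qed

section \<open>Approximation in square mean for a measure on a bounded interval\<close>

locale interval_prob_space = prob_space M for M :: "real measure" +
  fixes u v :: real
  assumes sets_eq_borel [measurable_cong, simp]: "sets M = sets borel"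
    and AE_interval: "AE x in M. x \<in> {u..v}"
begin

lemma L2_bounded:
  assumes [measurable]: "f \<in> borel_measurable borel" and "\<And>x. cmod (f x) \<le> B"
  shows "f \<in> L2_space M"
proof -
  have "norm ((cmod (f x))\<^sup>2) \<le> B\<^sup>2" for x
    using assms(2)[of x] by (simp add: power_mono)
  then have "integrable M (\<lambda>x. (cmod (f x))\<^sup>2)"
    by (intro integrable_const_bound[where B = "B\<^sup>2"]) auto
  then show ?thesis by (simp add: L2_space_def)
qed

lemma cmod_add_squared_le: "(cmod (a + b))\<^sup>2 \<le> 2 * (cmod a)\<^sup>2 + 2 * (cmod b)\<^sup>2"
proof -
  have "(cmod (a + b))\<^sup>2 \<le> (cmod a + cmod b)\<^sup>2"
    by (intro power_mono norm_triangle_ineq) simp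
  also have "\<dots> \<le> 2 * (cmod a)\<^sup>2 + 2 * (cmod b)\<^sup>2"
    using zero_le_power2[of "cmod a - cmod b"] by (simp add: power2_eq_square algebra_simps)
  finally show ?thesis .
qed

lemma L2_add:
  assumes "f \<in> L2_space M" and "g \<in> L2_space M"
  shows "(\<lambda>x. f x + g x) \<in> L2_space M"
proof -
  have [measurable]: "f \<in> borel_measurable M" "g \<in> borel_measurable M"
    and "integrable M (\<lambda>x. (cmod (f x))\<^sup>2)" "integrable M (\<lambda>x. (cmod (g x))\<^sup>2)"
    using assms by (auto simp: L2_space_def)
  then have "integrable M (\<lambda>x. 2 * (cmod (f x))\<^sup>2 + 2 * (cmod (g x))\<^sup>2)" by simp
  then have "integrable M (\<lambda>x. (cmod (f x + g x))\<^sup>2)"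
    by (rule Bochner_Integration.integrable_bound) (use cmod_add_squared_le in auto)
  then show ?thesis by (simp add: L2_space_def)
qed

lemma L2_scale: "f \<in> L2_space M \<Longrightarrow> (\<lambda>x. a * f x) \<in> L2_space M"
  by (auto simp: L2_space_def norm_mult power_mult_distrib)

lemma L2_diff: "f \<in> L2_space M \<Longrightarrow> g \<in> L2_space M \<Longrightarrow> (\<lambda>x. f x - g x) \<in> L2_space M"
  using L2_add[of f "\<lambda>x. - 1 * g x"] L2_scale[of g "- 1"] by simp

lemma L2_expo: "expo l \<in> L2_space M"
  by (rule L2_bounded[where B = 1]) auto

lemma L2_sum:
  assumes "finite F" and "\<And>i. i \<in> F \<Longrightarrow> f i \<in> L2_space M"
  shows "(\<lambda>x. \<Sum>i\<in>F. f i x) \<in> L2_space M"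
  using assms
proof (induction F rule: finite_induct)
  case empty
  show ?case by (simp add: L2_space_def)
qed (simp add: L2_add)

lemma L2_expo_span: "f \<in> expo_span L \<Longrightarrow> f \<in> L2_space M"
  by (auto simp: expo_span_def intro!: L2_sum L2_scale L2_expo)

text \<open>Squares avoid roots; the weak triangle inequality \<open>dist2_le\<close> with its
  factor 2 replaces Minkowski, whence the quarters of epsilon below.\<close>

definition dist2 :: "(real \<Rightarrow> complex) \<Rightarrow> (real \<Rightarrow> complex) \<Rightarrow> real" where
  "dist2 f g = (\<integral>x. (cmod (f x - g x))\<^sup>2 \<partial>M)"

lemma dist2_le:
  assumes "f1 \<in> L2_space M" "g1 \<in> L2_space M" "f2 \<in> L2_space M" "g2 \<in> L2_space M"
  shows "dist2 (\<lambda>x. f1 x + f2 x) (\<lambda>x. g1 x + g2 x) \<le> 2 * dist2 f1 g1 + 2 * dist2 f2 g2"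
proof -
  have i: "integrable M (\<lambda>x. (cmod (f1 x - g1 x))\<^sup>2)" "integrable M (\<lambda>x. (cmod (f2 x - g2 x))\<^sup>2)"
    using L2_diff[OF assms(1,2)] L2_diff[OF assms(3,4)] by (auto simp: L2_space_def)
  have "dist2 (\<lambda>x. f1 x + f2 x) (\<lambda>x. g1 x + g2 x)
      \<le> (\<integral>x. 2 * (cmod (f1 x - g1 x))\<^sup>2 + 2 * (cmod (f2 x - g2 x))\<^sup>2 \<partial>M)"
    unfolding dist2_def
  proof (rule integral_mono)
    show "integrable M (\<lambda>x. (cmod (f1 x + f2 x - (g1 x + g2 x)))\<^sup>2)"
      using L2_diff[OF L2_add[OF assms(1,3)] L2_add[OF assms(2,4)]] by (simp add: L2_space_def)
    fix x
    show "(cmod (f1 x + f2 x - (g1 x + g2 x)))\<^sup>2 \<le> 2 * (cmod (f1 x - g1 x))\<^sup>2 + 2 * (cmod (f2 x - g2 x))\<^sup>2"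
      using cmod_add_squared_le[of "f1 x - g1 x" "f2 x - g2 x"] by (simp add: algebra_simps)
  qed (use i in simp)
  also have "\<dots> = 2 * dist2 f1 g1 + 2 * dist2 f2 g2"
    using i by (simp add: dist2_def)
  finally show ?thesis .
qed

definition approximable :: "real set \<Rightarrow> (real \<Rightarrow> complex) \<Rightarrow> bool" where
  "approximable L f \<longleftrightarrow> f \<in> L2_space M \<and> (\<forall>\<epsilon>>0. \<exists>g\<in>expo_span L. dist2 f g < \<epsilon>)"

lemma approximable_add:
  assumes "approximable L f" and "approximable L g"
  shows "approximable L (\<lambda>x. f x + g x)"
  unfolding approximable_def
proof (intro conjI allI impI)
  show "(\<lambda>x. f x + g x) \<in> L2_space M"
    using assms by (simp add: approximable_def L2_add)
  fix \<epsilon> :: real assume "\<epsilon> > 0"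
  then have "\<epsilon> / 4 > 0" by simp
  then obtain f' g' where f': "f' \<in> expo_span L" "dist2 f f' < \<epsilon> / 4"
    and g': "g' \<in> expo_span L" "dist2 g g' < \<epsilon> / 4"
    using assms unfolding approximable_def by meson
  have "dist2 (\<lambda>x. f x + g x) (\<lambda>x. f' x + g' x) \<le> 2 * dist2 f f' + 2 * dist2 g g'"
    using assms f' g' by (intro dist2_le) (auto simp: approximable_def L2_expo_span)
  also have "\<dots> < \<epsilon>" using f' g' by simp
  finally show "\<exists>h\<in>expo_span L. dist2 (\<lambda>x. f x + g x) h < \<epsilon>"
    using expo_span_add f'(1) g'(1) by blast
qed

lemma approximable_scale:
  assumes "approximable L f"
  shows "approximable L (\<lambda>x. a * f x)"
  unfolding approximable_def
proof (intro conjI allI impI)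
  show "(\<lambda>x. a * f x) \<in> L2_space M"
    using assms by (simp add: approximable_def L2_scale)
  fix \<epsilon> :: real assume "\<epsilon> > 0"
  \<comment> \<open>The added 1 admits a = 0.\<close>
  moreover have "(cmod a)\<^sup>2 + 1 > 0" by (simp add: add_nonneg_pos)
  ultimately obtain f' where f': "f' \<in> expo_span L" "dist2 f f' < \<epsilon> / ((cmod a)\<^sup>2 + 1)"
    using assms unfolding approximable_def by (meson divide_pos_pos)
  have nn: "0 \<le> dist2 f f'" by (simp add: dist2_def)
  have "dist2 (\<lambda>x. a * f x) (\<lambda>x. a * f' x) = (cmod a)\<^sup>2 * dist2 f f'"
    by (simp add: dist2_def right_diff_distrib[symmetric] norm_mult power_mult_distrib)
  also have "\<dots> \<le> dist2 f f' * ((cmod a)\<^sup>2 + 1)"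
    using nn by (simp add: algebra_simps)
  also have "\<dots> < \<epsilon>"
    using f'(2) \<open>(cmod a)\<^sup>2 + 1 > 0\<close> by (simp add: pos_less_divide_eq)
  finally show "\<exists>h\<in>expo_span L. dist2 (\<lambda>x. a * f x) h < \<epsilon>"
    using expo_span_scale f'(1) by blast
qed

lemma approximable_closed:
  assumes "f \<in> L2_space M" and "\<And>\<epsilon>. \<epsilon> > 0 \<Longrightarrow> \<exists>h. approximable L h \<and> dist2 f h < \<epsilon>"
  shows "approximable L f"
  unfolding approximable_def
proof (intro conjI allI impI)
  fix \<epsilon> :: real assume "\<epsilon> > 0"
  then have "\<epsilon> / 4 > 0" by simp
  with assms(2) obtain h where h: "approximable L h" "dist2 f h < \<epsilon> / 4" by meson
  with \<open>\<epsilon> / 4 > 0\<close> obtain g where g: "g \<in> expo_span L" "dist2 h g < \<epsilon> / 4"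
    unfolding approximable_def by meson
  have h2: "h \<in> L2_space M" "g \<in> L2_space M"
    using h g by (auto simp: approximable_def L2_expo_span)
  \<comment> \<open>Written as two sums, so that the weak triangle inequality applies with h as the
    intermediate function.\<close>
  have "dist2 f g = dist2 (\<lambda>x. (f x - h x) + h x) (\<lambda>x. 0 * h x + g x)"
    by simp
  also have "\<dots> \<le> 2 * dist2 (\<lambda>x. f x - h x) (\<lambda>x. 0 * h x) + 2 * dist2 h g"
    using assms(1) h2 by (intro dist2_le L2_diff L2_scale)
  also have "dist2 (\<lambda>x. f x - h x) (\<lambda>x. 0 * h x) = dist2 f h"
    by (simp add: dist2_def)
  also have "2 * dist2 f h + 2 * dist2 h g < \<epsilon>" using h g by simp
  finally show "\<exists>g\<in>expo_span L. dist2 f g < \<epsilon>" using g by blast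
qed fact

text \<open>Serves three limits: ramps tending to the indicator of a half-line, countable disjoint
  unions, and simple functions tending to a square-integrable one.\<close>

lemma approximable_dominated:
  assumes f: "f \<in> L2_space M" and h: "\<And>n. approximable L (h n)"
    and lim: "\<And>x. (\<lambda>n. h n x) \<longlonglongrightarrow> f x"
    and w: "integrable M w" and bound: "\<And>n x. (cmod (f x - h n x))\<^sup>2 \<le> w x"
  shows "approximable L f"
proof (rule approximable_closed[OF f])
  have [measurable]: "f \<in> borel_measurable M" "\<And>n. h n \<in> borel_measurable M"
    using f h by (auto simp: approximable_def L2_space_def)
  have "(\<lambda>n. dist2 f (h n)) \<longlonglongrightarrow> (\<integral>x. 0 \<partial>M)"
    unfolding dist2_def
  proof (rule integral_dominated_convergence[OF _ _ w])
    have "(\<lambda>n. (cmod (f x - h n x))\<^sup>2) \<longlonglongrightarrow> (cmod (f x - f x))\<^sup>2" for x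
      by (intro tendsto_intros lim)
    then show "AE x in M. (\<lambda>n. (cmod (f x - h n x))\<^sup>2) \<longlonglongrightarrow> 0" by simp
  qed (use bound in auto)
  then have lim0: "(\<lambda>n. dist2 f (h n)) \<longlonglongrightarrow> 0" by simp
  fix \<epsilon> :: real assume "\<epsilon> > 0"
  then obtain n where "dist2 f (h n) < \<epsilon>"
    using eventually_happens'[OF sequentially_bot order_tendstoD(2)[OF lim0]] by blast
  then show "\<exists>h. approximable L h \<and> dist2 f h < \<epsilon>" using h by blast
qed

section \<open>From approximation of the exponentials to approximation of every square-integrable
  function\<close>

context
  fixes L :: "real set"
  assumes approximable_expo: "\<And>t. approximable L (expo t)"
begin

lemma approximable_trig_poly: "f \<in> trig_poly \<Longrightarrow> approximable L f"
  by (induction rule: trig_poly.induct)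
     (auto intro: approximable_expo approximable_add approximable_scale)

lemma approximable_continuous:
  fixes f :: "real \<Rightarrow> real"
  assumes "continuous_on UNIV f" and "\<And>x. \<bar>f x\<bar> \<le> B"
  shows "approximable L (\<lambda>x. complex_of_real (f x))"
proof (rule approximable_closed)
  have [measurable]: "f \<in> borel_measurable borel"
    by (rule borel_measurable_continuous_onI[OF assms(1)])
  show "(\<lambda>x. complex_of_real (f x)) \<in> L2_space M"
    using assms(2) by (intro L2_bounded[where B = B]) auto
  fix \<epsilon> :: real assume \<epsilon>: "\<epsilon> > 0"
  define e where "e = sqrt (\<epsilon> / 2)"
  have e: "e > 0" "e\<^sup>2 < \<epsilon>" using \<epsilon> by (simp_all add: e_def)
  obtain g where g: "(\<lambda>x. complex_of_real (g x)) \<in> trig_poly"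
    "\<And>x. x \<in> {u..v} \<Longrightarrow> \<bar>f x - g x\<bar> < e"
    using trig_poly_dense_continuous[OF continuous_on_subset[OF assms(1)] e(1)] by blast
  have "dist2 (\<lambda>x. of_real (f x)) (\<lambda>x. of_real (g x)) \<le> (\<integral>x. e\<^sup>2 \<partial>M)"
    unfolding dist2_def
  proof (rule integral_mono_AE')
    show "AE x in M. (cmod (complex_of_real (f x) - complex_of_real (g x)))\<^sup>2 \<le> e\<^sup>2"
      using AE_interval
    proof eventually_elim
      case (elim x)
      then have "\<bar>f x - g x\<bar> \<le> e" using g(2) by fastforce
      then have "cmod (complex_of_real (f x) - complex_of_real (g x)) \<le> e"
        by (metis norm_of_real of_real_diff)
      then show ?case by (intro power_mono) auto
    qed
  qed auto
  also have "\<dots> < \<epsilon>" using e(2) prob_space by simp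
  finally show "\<exists>h. approximable L h \<and> dist2 (\<lambda>x. of_real (f x)) h < \<epsilon>"
    using approximable_trig_poly[OF g(1)] by blast
qed

lemma approximable_indicator_atMost: "approximable L (\<lambda>x. indicator {..a} x)"
proof (rule approximable_dominated)
  \<comment> \<open>For n > 0 a continuous ramp: 1 up to a, then linear down to 0 at a +
    1/n.\<close>
  let ?f = "\<lambda>n x. max 0 (min 1 (1 - real n * (x - a)))"
  show "(\<lambda>x. indicator {..a} x) \<in> L2_space M"
    by (rule L2_bounded[where B = 1]) (auto simp: indicator_def)
  show "approximable L (\<lambda>x. complex_of_real (?f n x))" for n
    by (rule approximable_continuous[where B = 1]) (auto intro!: continuous_intros)
  show "(\<lambda>n. complex_of_real (?f n x)) \<longlonglongrightarrow> indicator {..a} x" for x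
  proof (cases "x \<le> a")
    case True
    then have "?f n x = 1" for n by (simp add: mult_nonneg_nonpos)
    then show ?thesis using True by simp
  next
    case False
    obtain N :: nat where N: "1 / (x - a) < real N" using reals_Archimedean2 by blast
    have "complex_of_real (?f n x) = 0" if "n \<ge> N" for n
    proof -
      have "1 / (x - a) \<le> real n" using N that by simp
      then have "1 \<le> real n * (x - a)" using False by (simp add: field_simps)
      then show ?thesis by simp
    qed
    then have "eventually (\<lambda>n. complex_of_real (?f n x) = 0) sequentially"
      by (auto simp: eventually_sequentially)
    then show ?thesis using False by (simp add: tendsto_eventually)
  qed
  show "integrable M (\<lambda>x. 1 :: real)" by simp
  show "(cmod (indicator {..a} x - complex_of_real (?f n x)))\<^sup>2 \<le> 1" for n x
  proof -
    have "\<bar>indicator {..a} x - ?f n x\<bar> \<le> 1" by (auto simp: indicator_def)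
    moreover have "indicator {..a} x - complex_of_real (?f n x) = complex_of_real (indicator {..a} x - ?f n x)"
      by (simp add: indicator_def)
    ultimately show ?thesis by (simp only: norm_of_real power_le_one abs_ge_zero)
  qed
qed

text \<open>Half-lines are stable under intersection and generate the Borel sets, so only
  complements and countable disjoint unions have to be checked.\<close>

lemma approximable_indicator:
  assumes "A \<in> sets borel"
  shows "approximable L (\<lambda>x. indicator A x)"
proof -
  have "Int_stable (range (\<lambda>a::real. {..a}))"
    by (auto simp: Int_stable_def)
  moreover have "range (\<lambda>a::real. {..a}) \<subseteq> Pow UNIV" by simp
  moreover have "A \<in> sigma_sets UNIV (range (\<lambda>a::real. {..a}))"
    using assms unfolding borel_eq_atMost by simp
  ultimately show ?thesis
  proof (induction rule: sigma_sets_induct_disjoint)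
    case (basic A)
    then show ?case using approximable_indicator_atMost by auto
  next
    case empty
    then show ?case using approximable_scale[OF approximable_expo, of 0] by simp
  next
    case (compl A)
    have "approximable L (\<lambda>x. expo 0 x + (- 1) * indicator A x)"
      by (intro approximable_add approximable_scale compl approximable_expo)
    also have "(\<lambda>x. expo 0 x + (- 1) * indicator A x) = (indicator (UNIV - A) :: real \<Rightarrow> complex)"
      by (auto simp: indicator_def fun_eq_iff)
    finally show ?case .
  next
    case (union A)
    have meas [measurable]: "A i \<in> sets borel" for i
      using union(2) unfolding borel_eq_atMost by auto
    show ?case
    proof (rule approximable_dominated)
      show "(\<lambda>x. indicator (\<Union>i. A i) x) \<in> L2_space M"
        by (rule L2_bounded[where B = 1]) (auto simp: indicator_def)
      show "approximable L (\<lambda>x. indicator (\<Union>i<n. A i) x)" for n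
      proof (induction n)
        case 0
        then show ?case using approximable_scale[OF approximable_expo, of 0] by simp
      next
        case (Suc n)
        have "A n \<inter> A i = {}" if "i < n" for i
          using disjoint_family_onD[OF union(1), of n i] that by simp
        then have "A n \<inter> (\<Union>i<n. A i) = {}" by blast
        then have "(\<lambda>x. indicator (\<Union>i<n. A i) x + indicator (A n) x) = (indicator (\<Union>i<Suc n. A i) :: real \<Rightarrow> complex)"
          by (auto simp: indicator_def fun_eq_iff less_Suc_eq)
        then show ?case using approximable_add[OF Suc union(3)[of n]] by simp
      qed
      show "(\<lambda>n. indicator (\<Union>i<n. A i) x) \<longlonglongrightarrow> (indicator (\<Union>i. A i) x :: complex)" for x
        by (rule LIMSEQ_indicator_UN)
      show "integrable M (\<lambda>x. 1 :: real)" by simp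
      show "(cmod (indicator (\<Union>i. A i) x - indicator (\<Union>i<n. A i) x))\<^sup>2 \<le> 1" for n x
        by (auto simp: indicator_def)
    qed
  qed
qed

lemma approximable_sum:
  assumes "finite F" and "\<And>i. i \<in> F \<Longrightarrow> approximable L (f i)"
  shows "approximable L (\<lambda>x. \<Sum>i\<in>F. f i x)"
  using assms
proof (induction F rule: finite_induct)
  case empty
  then show ?case using approximable_scale[OF approximable_expo, of 0] by simp
qed (simp add: approximable_add)

lemma approximable_L2:
  assumes f: "f \<in> L2_space M"
  shows "approximable L f"
proof -
  have [measurable]: "f \<in> borel_measurable M" and i: "integrable M (\<lambda>x. (cmod (f x))\<^sup>2)"
    using f by (auto simp: L2_space_def)
  have sp: "space M = UNIV" using sets_eq_imp_space_eq[OF sets_eq_borel] by simp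
  obtain F where F: "\<And>n. simple_function M (F n)" "\<And>x. (\<lambda>n. F n x) \<longlonglongrightarrow> f x"
    "\<And>n x. cmod (F n x) \<le> 2 * cmod (f x)"
    using borel_measurable_implies_sequence_metric[OF \<open>f \<in> borel_measurable M\<close>, of 0] by (auto simp: sp)
  show ?thesis
  proof (rule approximable_dominated[OF f])
    show "approximable L (F n)" for n
    proof -
      have fin: "finite (range (F n))" using simple_functionD(1)[OF F(1)[of n]] by (simp add: sp)
      have "F n = (\<lambda>x. \<Sum>y\<in>range (F n). y * indicator (F n -` {y}) x)"
      proof
        fix x
        have "(\<Sum>y\<in>range (F n). y * indicator (F n -` {y}) x) = (\<Sum>y\<in>{F n x}. y * indicator (F n -` {y}) x)"
          using fin by (intro sum.mono_neutral_right) (auto simp: indicator_def)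
        then show "F n x = (\<Sum>y\<in>range (F n). y * indicator (F n -` {y}) x)" by simp
      qed
      moreover have "approximable L (\<lambda>x. \<Sum>y\<in>range (F n). y * indicator (F n -` {y}) x)"
        using simple_functionD(2)[OF F(1)[of n]]
        by (intro approximable_sum approximable_scale approximable_indicator fin) (simp add: sp)
      ultimately show ?thesis by simp
    qed
    show "(\<lambda>n. F n x) \<longlonglongrightarrow> f x" for x by (rule F(2))
    \<comment> \<open>With |F n x| <= 2 |f x| the difference is at most 3 |f x|, whose square is the
      integrable bound.\<close>
    show "integrable M (\<lambda>x. 9 * (cmod (f x))\<^sup>2)" using i by simp
    show "(cmod (f x - F n x))\<^sup>2 \<le> 9 * (cmod (f x))\<^sup>2" for n x
    proof -
      have "cmod (f x - F n x) \<le> 3 * cmod (f x)"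
        using norm_triangle_ineq4[of "f x" "F n x"] F(3)[of n x] by simp
      then have "(cmod (f x - F n x))\<^sup>2 \<le> (3 * cmod (f x))\<^sup>2" by (intro power_mono) auto
      then show ?thesis by (simp add: power_mult_distrib)
    qed
  qed
qed

end

lemma L2_norm_less_iff: "\<epsilon> > 0 \<Longrightarrow> L2_norm M (\<lambda>x. f x - g x) < \<epsilon> \<longleftrightarrow> dist2 f g < \<epsilon>\<^sup>2"
  unfolding L2_norm_def dist2_def using real_sqrt_less_iff[of _ "\<epsilon>\<^sup>2"] by simp

text \<open>Completeness is thereby tested on exponentials alone, for which the error of
  approximation is explicit, see \<open>dist2_expo\<close>.\<close>

lemma is_spectrum_iff:
  "is_spectrum M L \<longleftrightarrow> orthogonal_set M L \<and> (\<forall>t. approximable L (expo t))"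
proof -
  have *: "(\<exists>F c. finite F \<and> F \<subseteq> L \<and> L2_norm M (\<lambda>x. f x - (\<Sum>l\<in>F. c l * expo l x)) < \<epsilon>)
      \<longleftrightarrow> (\<exists>g\<in>expo_span L. dist2 f g < \<epsilon>\<^sup>2)" if "\<epsilon> > 0" for f \<epsilon>
    by (auto simp: expo_span_def L2_norm_less_iff[OF that])
  have iff: "(\<forall>\<epsilon>>0. \<exists>F c. finite F \<and> F \<subseteq> L \<and> L2_norm M (\<lambda>x. f x - (\<Sum>l\<in>F. c l * expo l x)) < \<epsilon>)
      \<longleftrightarrow> approximable L f" if f: "f \<in> L2_space M" for f
  proof
    assume a: "\<forall>\<epsilon>>0. \<exists>F c. finite F \<and> F \<subseteq> L \<and> L2_norm M (\<lambda>x. f x - (\<Sum>l\<in>F. c l * expo l x)) < \<epsilon>"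
    have "\<exists>g\<in>expo_span L. dist2 f g < \<epsilon>" if "\<epsilon> > 0" for \<epsilon>
      using a[rule_format, of "sqrt \<epsilon>"] *[of "sqrt \<epsilon>" f] that by simp
    then show "approximable L f" using f by (simp add: approximable_def)
  next
    assume "approximable L f"
    show "\<forall>\<epsilon>>0. \<exists>F c. finite F \<and> F \<subseteq> L \<and> L2_norm M (\<lambda>x. f x - (\<Sum>l\<in>F. c l * expo l x)) < \<epsilon>"
    proof (intro allI impI)
      fix \<epsilon> :: real assume "\<epsilon> > 0"
      then show "\<exists>F c. finite F \<and> F \<subseteq> L \<and> L2_norm M (\<lambda>x. f x - (\<Sum>l\<in>F. c l * expo l x)) < \<epsilon>"
        using \<open>approximable L f\<close> unfolding *[OF \<open>\<epsilon> > 0\<close>] by (simp add: approximable_def)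
    qed
  qed
  have "is_spectrum M L \<longleftrightarrow> orthogonal_set M L \<and> (\<forall>f\<in>L2_space M. approximable L f)"
    unfolding is_spectrum_def by (intro conj_cong ball_cong refl iff)
  moreover have "(\<forall>f\<in>L2_space M. approximable L f) \<longleftrightarrow> (\<forall>t. approximable L (expo t))"
    using approximable_L2[of L] L2_expo by auto
  ultimately show ?thesis by simp
qed

end

section \<open>The frequencies given by \<open>\<kappa>\<close>\<close>

locale cantor_parameters =
  fixes q b :: nat
  assumes q_ge_2: "q \<ge> 2" and q_dvd_b: "q dvd b" and b_div_q: "b div q \<ge> 2" and b_gt_4: "b > 4"
begin

lemma two_q_le_b: "2 * q \<le> b"
  using b_div_q q_dvd_b by (metis dvd_div_mult_self mult_le_mono1)

text \<open>For b = 5 the bound 2q <= b leaves only q = 2, which does not divide 5.\<close>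

lemma b_ge_6: "b \<ge> 6"
proof (rule ccontr)
  assume "\<not> b \<ge> 6"
  then have "b = 5" using b_gt_4 by simp
  with two_q_le_b q_ge_2 q_dvd_b have "q \<le> 2" by simp
  then have "q = 2" using q_ge_2 by simp
  with \<open>b = 5\<close> q_dvd_b show False by simp
qed

text \<open>Indexed by the exponent of b, hence the prefix of length k + 1.\<close>

definition kdigit :: "nat list \<Rightarrow> nat \<Rightarrow> int" where
  "kdigit w k = kappa q b (prefix0 (Suc k) w)"

lemma prefix0_append_zeros: "prefix0 k (w @ replicate m 0) = prefix0 k w"
  by (rule nth_equalityI) (auto simp: prefix0_def nth_append)

lemma prefix0_take: "k \<le> length w \<Longrightarrow> prefix0 k w = take k w"
  by (simp add: prefix0_def)

lemma prefix0_extend: "prefix0 (length w + k) w = w @ replicate k 0"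
  by (simp add: prefix0_def min_def)

lemma prefix0_words: "set w \<subseteq> {..<q} \<Longrightarrow> prefix0 (Suc k) w \<in> words q"
  using q_ge_2 by (auto simp: words_def prefix0_def dest!: in_set_takeD)

lemma kdigit_append_zeros: "kdigit (w @ replicate m 0) k = kdigit w k"
  by (simp add: kdigit_def prefix0_append_zeros)

lemma kdigit_append_less: "k < length w \<Longrightarrow> kdigit (w @ v) k = kdigit w k"
  by (simp add: kdigit_def prefix0_take)

lemma kdigit_zeros: "kdigit (replicate m 0) k = 0"
proof -
  have "prefix0 (Suc k) (replicate m 0) = replicate (Suc k) 0"
    by (simp add: prefix0_def replicate_add[symmetric] del: replicate_Suc)
  then show ?thesis by (simp only: kdigit_def kappa_zeros)
qed

lemma word_cases:
  assumes "set w \<subseteq> {..<q}"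
  obtains (zeros) m where "w = replicate m 0"
  | (append) d m where "d \<noteq> []" "set d \<subseteq> {..<q}" "last d \<noteq> 0" "last d < q" "w = d @ replicate m 0"
proof (cases "w = []")
  case True
  then show thesis using zeros[of 0] by simp
next
  case False
  then have "w \<in> words q" using assms by (auto simp: words_def)
  then show thesis
  proof (cases rule: words_cases)
    case (append d k)
    then have d: "d \<noteq> []" "set d \<subseteq> {..<q}" by (auto simp: words_def)
    then have "last d < q" using last_in_set[OF d(1)] by blast
    with d append show thesis using that(2)[of d k] by blast
  qed (use zeros in blast)
qed

definition run_length :: "nat list \<Rightarrow> nat" where
  "run_length d = K_index q b (\<Sum>i = 1..length d - 1. kappa q b (prefix0 i d)) (last d)"

lemma
  shows run_length_le: "run_length d \<le> b - 2"
    and run_length_dvd: "int b - 1 dvd (\<Sum>i = 1..length d - 1. kappa q b (prefix0 i d))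
      + int q * (int (run_length d) + 1) + int (last d)"
  using theI'[OF ex1_K_index[of q b "\<Sum>i = 1..length d - 1. kappa q b (prefix0 i d)" "last d"]]
    q_dvd_b b_gt_4
  unfolding run_length_def K_index_def by auto

text \<open>Position \<open>length d + k\<close> belongs to d followed by k + 1 zeros, so the run
  1..K becomes k < K, and n + 2b - 1 becomes n + 2b - 2.\<close>

lemma kdigit_tail:
  assumes "d \<noteq> []" and "last d \<noteq> 0"
  shows "kdigit d (length d + k) = (if k < run_length d \<or> k = length d + 2 * b - 2 then int q else 0)"
proof -
  have "kdigit d (length d + k) = kappa q b (d @ replicate (Suc k) 0)"
    using prefix0_extend[of d "Suc k"] by (simp add: kdigit_def)
  also have "\<dots> = (if k < run_length d \<or> k = length d + 2 * b - 2 then int q else 0)"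
    unfolding kappa_append_zeros[OF assms] run_length_def[symmetric] using b_gt_4 by auto
  finally show ?thesis .
qed

lemma kdigit_last:
  assumes "d \<noteq> []" and "last d \<noteq> 0"
  shows "kdigit d (length d - 1) = int (last d)"
  using kappa_append_zeros[OF assms, of q b 0] assms by (simp add: kdigit_def prefix0_take)

lemma kappa_bounds:
  assumes "w \<in> words q"
  shows "0 \<le> kappa q b w" and "kappa q b w \<le> int q"
proof -
  have "set w \<subseteq> {..<q}" using assms by (auto simp: words_def)
  then have "0 \<le> kappa q b w \<and> kappa q b w \<le> int q"
    by (cases rule: word_cases) (auto simp: kappa_zeros kappa_append_zeros)
  then show "0 \<le> kappa q b w" and "kappa q b w \<le> int q" by auto
qed

lemma kdigit_bounds:
  assumes "set w \<subseteq> {..<q}"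
  shows "0 \<le> kdigit w k" and "kdigit w k \<le> int q"
  using kappa_bounds[OF prefix0_words[OF assms]] by (auto simp: kdigit_def)

lemma kdigit_eventually_0:
  assumes "set w \<subseteq> {..<q}" and "k \<ge> 2 * length w + 2 * b"
  shows "kdigit w k = 0"
  using assms(1)
proof (cases rule: word_cases)
  case (append d m)
  have "k = length d + (k - length d)" using assms(2) append by simp
  moreover have "\<not> k - length d < run_length d" "k - length d \<noteq> length d + 2 * b - 2"
    using assms(2) append run_length_le[of d] b_gt_4 by auto
  ultimately show ?thesis
    using kdigit_tail[OF append(1,3), of "k - length d"] append by (simp add: kdigit_append_zeros)
qed (simp add: kdigit_zeros)

text \<open>A finite form of the series in \<open>Lambda_set\<close>: the cutoff lies past the last
  possible nonzero digit, in position 2n + 2b - 2 for a word of length n.\<close>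

definition frequency :: "nat list \<Rightarrow> int" where
  "frequency w = (\<Sum>k<2 * length w + 2 * b. kdigit w k * int b ^ k)"

lemma frequency_eq:
  assumes "set w \<subseteq> {..<q}" and "N \<ge> 2 * length w + 2 * b"
  shows "frequency w = (\<Sum>k<N. kdigit w k * int b ^ k)"
  unfolding frequency_def using assms
  by (intro sum.mono_neutral_left) (auto simp: kdigit_eventually_0)

lemma frequency_split:
  assumes "set w \<subseteq> {..<q}"
  shows "frequency w = (\<Sum>k<n. kdigit w k * int b ^ k)
    + int b ^ n * (\<Sum>k<2 * length w + 2 * b. kdigit w (n + k) * int b ^ k)"
proof -
  have "frequency w = (\<Sum>k<n + (2 * length w + 2 * b). kdigit w k * int b ^ k)"
    using assms by (intro frequency_eq) auto
  also have "\<dots> = (\<Sum>k<n. kdigit w k * int b ^ k)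
      + (\<Sum>k = n..<n + (2 * length w + 2 * b). kdigit w k * int b ^ k)"
    by (simp add: lessThan_atLeast0 sum.atLeastLessThan_concat)
  also have "(\<Sum>k = n..<n + (2 * length w + 2 * b). kdigit w k * int b ^ k)
      = int b ^ n * (\<Sum>k<2 * length w + 2 * b. kdigit w (n + k) * int b ^ k)"
    using sum.shift_bounds_nat_ivl[of "\<lambda>k. kdigit w k * int b ^ k" 0 n "2 * length w + 2 * b"]
    by (simp add: lessThan_atLeast0 sum_distrib_left power_add algebra_simps)
  finally show ?thesis .
qed

lemma frequency_append_zeros:
  assumes "set w \<subseteq> {..<q}"
  shows "frequency (w @ replicate m 0) = frequency w"
proof -
  have "set (w @ replicate m 0) \<subseteq> {..<q}" using assms q_ge_2 by auto
  then have "frequency (w @ replicate m 0) = (\<Sum>k<2 * (length w + m) + 2 * b. kdigit w k * int b ^ k)"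
    by (subst frequency_eq[of _ "2 * (length w + m) + 2 * b"]) (auto simp: kdigit_append_zeros)
  also have "\<dots> = frequency w" using assms by (intro frequency_eq[symmetric]) auto
  finally show ?thesis .
qed

lemma frequency_append_cong:
  assumes "set w \<subseteq> {..<q}" and "i < q"
  shows "int b ^ length w dvd frequency (w @ [i]) - frequency w"
proof -
  have "set (w @ [i]) \<subseteq> {..<q}" using assms by auto
  from frequency_split[OF this, of "length w"] frequency_split[OF assms(1), of "length w"]
  show ?thesis
    by (auto simp: kdigit_append_less intro!: dvd_diff)
qed

lemma kdigit_append_mod:
  assumes "set w \<subseteq> {..<q}" and "i < q"
  shows "int q dvd kdigit (w @ [i]) (length w) - int i"
proof -
  have "w @ [i] \<in> words q" using assms by (auto simp: words_def)
  then have "int q dvd kappa q b (w @ [i]) - int i"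
    using tree_mapping_kappa[OF q_ge_2 q_dvd_b b_div_q] unfolding tree_mapping_def by fastforce
  then show ?thesis by (simp add: kdigit_def prefix0_take)
qed

text \<open>The digit in position \<open>length w\<close> is congruent to the last letter modulo q,
  and all later digits carry at least one more factor b, a multiple of q.\<close>

lemma frequency_append_inj:
  assumes "set w \<subseteq> {..<q}" and "i < q" and "j < q"
    and "int b ^ length w * int q dvd frequency (w @ [i]) - frequency (w @ [j])"
  shows "i = j"
proof -
  let ?n = "length w"
  have *: "\<exists>t. frequency (w @ [i]) = (\<Sum>k<?n. kdigit w k * int b ^ k)
      + int b ^ ?n * (int i + int q * t)" if i: "i < q" for i
  proof -
    have "set (w @ [i]) \<subseteq> {..<q}" using assms i by auto
    from frequency_split[OF this, of "Suc ?n"] obtain s where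
      s: "frequency (w @ [i]) = (\<Sum>k<Suc ?n. kdigit (w @ [i]) k * int b ^ k) + int b ^ Suc ?n * s"
      by blast
    obtain t where t: "kdigit (w @ [i]) ?n = int i + int q * t"
      using kdigit_append_mod[OF assms(1) i] by (metis add.commute diff_add_cancel dvdE)
    obtain p where p: "b = q * p" using q_dvd_b by blast
    have "frequency (w @ [i]) = (\<Sum>k<?n. kdigit w k * int b ^ k)
      + int b ^ ?n * (int i + int q * (t + int p * s))"
      unfolding s by (simp add: kdigit_append_less t) (simp add: p algebra_simps)
    then show ?thesis by blast
  qed
  obtain t where t: "frequency (w @ [i]) = (\<Sum>k<?n. kdigit w k * int b ^ k) + int b ^ ?n * (int i + int q * t)"
    using *[OF assms(2)] by blast
  obtain t' where t': "frequency (w @ [j]) = (\<Sum>k<?n. kdigit w k * int b ^ k) + int b ^ ?n * (int j + int q * t')"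
    using *[OF assms(3)] by blast
  have "frequency (w @ [i]) - frequency (w @ [j]) = int b ^ ?n * (int i - int j + int q * (t - t'))"
    unfolding t t' by (simp add: algebra_simps)
  with assms(4) have "int q dvd int i - int j + int q * (t - t')"
    using b_gt_4 by simp
  then have "int q dvd int i - int j" by (simp add: dvd_add_left_iff)
  then show ?thesis
    using assms(2,3) zdvd_imp_le[of "int q" "\<bar>int i - int j\<bar>"] by (cases "i = j") auto
qed

lemma Lambda_set_eq: "Lambda_set q b = (\<lambda>w. of_int (frequency w)) ` {w. set w \<subseteq> {..<q}}"
proof -
  have *: "(\<Sum>k. real_of_int (kappa q b (prefix0 (Suc k) w)) * real b ^ k) = of_int (frequency w)"
    if "set w \<subseteq> {..<q}" for w
    unfolding frequency_def of_int_sum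
    by (subst suminf_finite[of "{..<2 * length w + 2 * b}"])
       (use kdigit_eventually_0[OF that] in \<open>auto simp: kdigit_def\<close>)
  have w: "set w \<subseteq> {..<q}" if "w \<in> words q" for w
    using that by (auto simp: words_def)
  have "Lambda_set q b = {of_int (frequency w) | w. w \<in> words q}"
    unfolding Lambda_set_def by (intro Collect_cong ex_cong1) (auto simp: *[OF w])
  then have "Lambda_set q b = (\<lambda>w. of_int (frequency w)) ` words q"
    by (simp only: Setcompr_eq_image)
  \<comment> \<open>The tree starts at the empty word, which is not in \<open>words q\<close>; the
    word [0] has the same integer.\<close>
  moreover have "frequency [] = frequency [0]"
    using frequency_append_zeros[of "[]" 1] by simp
  moreover have "{w. set w \<subseteq> {..<q}} = insert [] (words q)" "[0] \<in> words q"
    using q_ge_2 by (auto simp: words_def)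
  ultimately show ?thesis by (simp add: insert_absorb rev_image_eqI)
qed

text \<open>With n the length of d, the run ends before position n + b - 2, because K <= b - 2,
  while the isolated digit q sits at 2n + 2b - 2. Between them lies a gap of n + b zeros, longer
  than the word, which division by b - 1 in effect fills with digits q.\<close>

lemma frequency_stripped:
  assumes "d \<noteq> []" and "set d \<subseteq> {..<q}" and "last d \<noteq> 0"
  shows "frequency d = (\<Sum>k<length d + b - 2. kdigit d k * int b ^ k) + int q * int b ^ (2 * length d + 2 * b - 2)"
proof -
  let ?n = "length d"
  have "kdigit d k = 0" if "k \<ge> ?n + b - 2" "k \<noteq> 2 * ?n + 2 * b - 2" for k
    using kdigit_tail[OF assms(1,3), of "k - ?n"] that run_length_le[of d] b_gt_4 by auto
  then have "frequency d = (\<Sum>k\<in>{..<?n + b - 2} \<union> {2 * ?n + 2 * b - 2}. kdigit d k * int b ^ k)"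
    unfolding frequency_def using b_gt_4 by (intro sum.mono_neutral_right) auto
  also have "\<dots> = (\<Sum>k<?n + b - 2. kdigit d k * int b ^ k) + kdigit d (2 * ?n + 2 * b - 2) * int b ^ (2 * ?n + 2 * b - 2)"
    using b_gt_4 by (subst sum.union_disjoint) auto
  also have "kdigit d (2 * ?n + 2 * b - 2) = int q"
    using kdigit_tail[OF assms(1,3), of "?n + 2 * b - 2"] b_gt_4 by simp
  finally show ?thesis .
qed

text \<open>Modulo b - 1 every power of b is 1, so the digit sum decides. Behind the word stand K
  digits q of the run and the isolated one, which is the extra 1 in K + 1; the congruence defining
  \<open>K_index\<close> makes the total vanish.\<close>

lemma pred_b_dvd_frequency:
  assumes "set w \<subseteq> {..<q}"
  shows "int b - 1 dvd frequency w"
  using assms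
proof (cases rule: word_cases)
  case (zeros m)
  then show ?thesis by (simp add: frequency_def kdigit_zeros)
next
  case (append d m)
  let ?n = "length d" and ?K = "run_length d"
  have "int b - 1 dvd (\<Sum>k<2 * ?n + 2 * b. kdigit d k * int b ^ k) - (\<Sum>k<2 * ?n + 2 * b. kdigit d k)"
    unfolding sum_subtractf[symmetric]
  proof (rule dvd_sum)
    fix k
    have "int b - 1 dvd int b ^ k - 1"
      by (simp add: power_diff_1_eq)
    then have "int b - 1 dvd kdigit d k * (int b ^ k - 1)" by simp
    then show "int b - 1 dvd kdigit d k * int b ^ k - kdigit d k" by (simp add: algebra_simps)
  qed
  moreover have "(\<Sum>k<2 * ?n + 2 * b. kdigit d k)
      = (\<Sum>i = 1..?n - 1. kappa q b (prefix0 i d)) + int q * (int ?K + 1) + int (last d)"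
  proof -
    have "(\<Sum>k<2 * ?n + 2 * b. kdigit d k) = (\<Sum>k<?n. kdigit d k) + (\<Sum>k<?n + 2 * b. kdigit d (?n + k))"
      using sum.shift_bounds_nat_ivl[of "kdigit d" 0 ?n "?n + 2 * b"]
        sum.atLeastLessThan_concat[of 0 ?n "?n + (?n + 2 * b)" "kdigit d"]
      by (simp add: lessThan_atLeast0 add.commute)
    also have "(\<Sum>k<?n. kdigit d k) = (\<Sum>k<?n - 1. kdigit d k) + int (last d)"
      using kdigit_last[OF append(1,3)] append(1) by (cases ?n) auto
    also have "(\<Sum>k<?n - 1. kdigit d k) = (\<Sum>i = 1..?n - 1. kappa q b (prefix0 i d))"
    proof -
      have "{1..?n - 1} = {0 + 1..<(?n - 1) + 1}" using append(1) by (cases ?n) auto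
      then show ?thesis
        by (simp only: sum.shift_bounds_nat_ivl kdigit_def lessThan_atLeast0 Suc_eq_plus1)
    qed
    also have "(\<Sum>k<?n + 2 * b. kdigit d (?n + k)) = (\<Sum>k\<in>insert (?n + 2 * b - 2) {..<?K}. int q)"
      using run_length_le[of d] b_gt_4 unfolding kdigit_tail[OF append(1,3)]
      by (intro sum.mono_neutral_cong_right) auto
    also have "\<dots> = int q * (int ?K + 1)"
      using run_length_le[of d] b_gt_4 by (simp add: algebra_simps)
    finally show ?thesis by simp
  qed
  ultimately have "int b - 1 dvd (\<Sum>k<2 * ?n + 2 * b. kdigit d k * int b ^ k)
      - (\<Sum>k<2 * ?n + 2 * b. kdigit d k) + (\<Sum>k<2 * ?n + 2 * b. kdigit d k)"
    using run_length_dvd[of d] by (intro dvd_add) simp_all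
  then have "int b - 1 dvd (\<Sum>k<2 * ?n + 2 * b. kdigit d k * int b ^ k)"
    by simp
  then show ?thesis
    using append by (simp add: frequency_append_zeros) (simp add: frequency_def)
qed

text \<open>The geometric series, multiplied by b - 1 to stay within the integers.\<close>

lemma sum_kdigit_le:
  assumes "set w \<subseteq> {..<q}"
  shows "(\<Sum>k<n. kdigit w k * int b ^ k) * (int b - 1) \<le> int q * (int b ^ n - 1)"
proof -
  have "(\<Sum>k<n. kdigit w k * int b ^ k) * (int b - 1) \<le> (\<Sum>k<n. int q * int b ^ k) * (int b - 1)"
    using kdigit_bounds[OF assms] b_gt_4 by (intro mult_right_mono sum_mono) auto
  also have "\<dots> = int q * (int b ^ n - 1)"
    by (simp add: sum_distrib_left[symmetric] power_diff_1_eq mult_ac)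
  finally show ?thesis .
qed

lemma sum_kdigit_nonneg:
  "set w \<subseteq> {..<q} \<Longrightarrow> 0 \<le> (\<Sum>k<n. kdigit w k * int b ^ k)"
  by (intro sum_nonneg) (simp add: kdigit_bounds)

lemma kdigit_beyond_length:
  assumes "set w \<subseteq> {..<q}"
  shows "kdigit w (length w + k) \<in> {0, int q}"
  using assms
proof (cases rule: word_cases)
  case (append d m)
  then show ?thesis using kdigit_tail[OF append(1,3), of "m + k"]
    by (simp add: kdigit_append_zeros add.assoc)
qed (simp add: kdigit_zeros)

text \<open>Only the run and the isolated digit count, at most K + 1 <= b digits q however long the
  word is; the constant in the lower bound owes its uniformity to this.\<close>

lemma sum_kdigit_beyond_length:
  assumes "set w \<subseteq> {..<q}"
  shows "(\<Sum>k<N. kdigit w (length w + k)) \<le> int q * int b"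
  using assms
proof (cases rule: word_cases)
  case (append d m)
  let ?n = "length d" and ?K = "run_length d"
  \<comment> \<open>With m trailing zeros in w, counting starts m places into the tail of d.\<close>
  let ?I = "{k\<in>{..<N}. m + k \<in> insert (?n + 2 * b - 2) {..<?K}}"
  have "(\<Sum>k<N. kdigit w (length w + k)) = (\<Sum>k<N. kdigit d (?n + (m + k)))"
    by (simp add: append kdigit_append_zeros add.assoc)
  also have "\<dots> = (\<Sum>k\<in>?I. int q)"
    unfolding kdigit_tail[OF append(1,3)] by (intro sum.mono_neutral_cong_right) auto
  also have "\<dots> = int q * int (card ?I)" by simp
  also have "\<dots> \<le> int q * int b"
  proof -
    have "card ?I = card ((\<lambda>k. m + k) ` ?I)" by (simp add: card_image)
    also have "\<dots> \<le> card (insert (?n + 2 * b - 2) {..<?K})" by (intro card_mono) auto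
    also have "\<dots> \<le> Suc ?K" by (simp add: card_insert_if)
    also have "\<dots> \<le> b" using run_length_le[of d] b_gt_4 by simp
    finally show ?thesis by (intro mult_left_mono of_nat_mono) auto
  qed
  finally show ?thesis .
qed (simp add: kdigit_zeros)

end

section \<open>Spectra of the Cantor measure\<close>

locale cantor_space = self_similar_measure M q b + interval_prob_space M u v for M q b u v
begin

text \<open>The square completed in the coefficients: the last sum vanishes at the Fourier
  coefficients, and the Bessel defect remains.\<close>

lemma dist2_expo:
  assumes "finite F" and orth: "pairwise (\<lambda>l l'. mu_hat (l - l') = 0) F"
  shows "dist2 (expo t) (\<lambda>x. \<Sum>l\<in>F. c l * expo l x)
    = 1 - (\<Sum>l\<in>F. (cmod (mu_hat (t - l)))\<^sup>2) + (\<Sum>l\<in>F. (cmod (c l - mu_hat (t - l)))\<^sup>2)"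
proof -
  let ?d = "\<lambda>x. expo t x - (\<Sum>l\<in>F. c l * expo l x)"
  have expand: "complex_of_real ((cmod (?d x))\<^sup>2) = 1 - (\<Sum>l\<in>F. cnj (c l) * expo (t - l) x)
      - (\<Sum>l\<in>F. c l * expo (l - t) x) + (\<Sum>l\<in>F. \<Sum>k\<in>F. c l * cnj (c k) * expo (l - k) x)" for x
  proof -
    have "complex_of_real ((cmod (?d x))\<^sup>2) = ?d x * cnj (?d x)"
      by (simp only: complex_norm_square)
    also have "\<dots> = expo t x * cnj (expo t x) - (\<Sum>l\<in>F. cnj (c l) * (expo t x * cnj (expo l x)))
        - (\<Sum>l\<in>F. c l * (expo l x * cnj (expo t x)))
        + (\<Sum>l\<in>F. \<Sum>k\<in>F. c l * cnj (c k) * (expo l x * cnj (expo k x)))"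
      by (simp add: algebra_simps sum_distrib_left sum_distrib_right) (rule sum.swap)
    finally show ?thesis by (simp add: expo_mult_cnj)
  qed
  have "complex_of_real (dist2 (expo t) (\<lambda>x. \<Sum>l\<in>F. c l * expo l x))
      = (\<integral>x. complex_of_real ((cmod (?d x))\<^sup>2) \<partial>M)"
    unfolding dist2_def by (rule integral_complex_of_real[symmetric])
  also have "\<dots> = 1 - (\<Sum>l\<in>F. cnj (c l) * mu_hat (t - l))
      - (\<Sum>l\<in>F. c l * mu_hat (l - t)) + (\<Sum>l\<in>F. \<Sum>k\<in>F. c l * cnj (c k) * mu_hat (l - k))"
    unfolding expand using prob_space by (simp add: mu_hat_def)
  also have "(\<Sum>l\<in>F. \<Sum>k\<in>F. c l * cnj (c k) * mu_hat (l - k)) = (\<Sum>l\<in>F. c l * cnj (c l))"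
  proof (rule sum.cong[OF refl])
    fix l assume l: "l \<in> F"
    have "(\<Sum>k\<in>F. c l * cnj (c k) * mu_hat (l - k)) = (\<Sum>k\<in>{l}. c l * cnj (c k) * mu_hat (l - k))"
      using assms(1) l orth by (intro sum.mono_neutral_right) (auto simp: pairwise_def)
    then show "(\<Sum>k\<in>F. c l * cnj (c k) * mu_hat (l - k)) = c l * cnj (c l)"
      by (simp add: mu_hat_0)
  qed
  also have "1 - (\<Sum>l\<in>F. cnj (c l) * mu_hat (t - l)) - (\<Sum>l\<in>F. c l * mu_hat (l - t)) + (\<Sum>l\<in>F. c l * cnj (c l))
      = complex_of_real (1 - (\<Sum>l\<in>F. (cmod (mu_hat (t - l)))\<^sup>2) + (\<Sum>l\<in>F. (cmod (c l - mu_hat (t - l)))\<^sup>2))"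
  proof -
    have "mu_hat (l - t) = cnj (mu_hat (t - l))" for l
      using mu_hat_minus[of "t - l"] by simp
    then show ?thesis
      by (simp add: complex_norm_square algebra_simps sum_subtractf sum.distrib del: of_real_power)
  qed
  finally show ?thesis unfolding of_real_eq_iff .
qed

lemma bessel_inequality:
  assumes "finite F" and "pairwise (\<lambda>l l'. mu_hat (l - l') = 0) F"
  shows "1 - (\<Sum>l\<in>F. (cmod (mu_hat (t - l)))\<^sup>2) \<le> dist2 (expo t) (\<lambda>x. \<Sum>l\<in>F. c l * expo l x)"
  unfolding dist2_expo[OF assms] by (simp add: sum_nonneg)

lemma orthogonal_setD:
  "orthogonal_set M \<Lambda> \<Longrightarrow> F \<subseteq> \<Lambda> \<Longrightarrow> pairwise (\<lambda>l l'. mu_hat (l - l') = 0) F"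
  by (auto simp: orthogonal_set_def L2_inner_expo pairwise_def)

text \<open>An exponential orthogonal to the whole set would keep distance at least 1 from its span.
  Maximality of the rescaled set is derived from this.\<close>

lemma spectrum_not_orthogonal:
  assumes "is_spectrum M \<Lambda>"
  shows "\<exists>l\<in>\<Lambda>. mu_hat (t - l) \<noteq> 0"
proof (rule ccontr)
  assume 0: "\<not> ?thesis"
  have "approximable \<Lambda> (expo t)" and orth: "orthogonal_set M \<Lambda>"
    using assms by (auto simp: is_spectrum_iff)
  then obtain g where "g \<in> expo_span \<Lambda>" "dist2 (expo t) g < 1"
    unfolding approximable_def by (meson zero_less_one)
  then obtain F c where F: "finite F" "F \<subseteq> \<Lambda>" "dist2 (expo t) (\<lambda>x. \<Sum>l\<in>F. c l * expo l x) < 1"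
    by (auto simp: expo_span_def)
  have "(\<Sum>l\<in>F. (cmod (mu_hat (t - l)))\<^sup>2) = 0"
    using 0 F(2) by (intro sum.neutral) auto
  then show False
    using bessel_inequality[OF F(1) orthogonal_setD[OF orth F(2)], of t c] F(3) by simp
qed

end

locale cantor_tree = cantor_space M q b u v + residue_tree M q b L for M q b u v L
begin

lemma sum_level_frequencies:
  "(\<Sum>l\<in>(\<lambda>w. of_int (L w)) ` level n. (cmod (mu_hat (t - l)))\<^sup>2) = bessel_sum n (- t)"
proof -
  have "cmod (mu_hat (t - of_int (L w))) = cmod (mu_hat (- t + of_int (L w)))" for w
    using norm_mu_hat_minus[of "t - of_int (L w)"] by simp
  then show ?thesis
    by (simp add: sum.reindex[OF inj_on_L_level] bessel_sum_def power_spectrum_def)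
qed

lemma is_spectrum_frequencies:
  assumes "\<And>x. (\<lambda>n. bessel_sum n x) \<longlonglongrightarrow> 1"
  shows "is_spectrum M frequencies"
  unfolding is_spectrum_iff approximable_def
proof (intro conjI allI impI orthogonal_frequencies L2_expo)
  fix t \<epsilon> :: real assume "\<epsilon> > 0"
  then obtain n where n: "1 - \<epsilon> < bessel_sum n (- t)"
    using eventually_happens'[OF sequentially_bot order_tendstoD(1)[OF assms[of "- t"], of "1 - \<epsilon>"]] by auto
  let ?F = "(\<lambda>w. real_of_int (L w)) ` level n"
  have orth: "pairwise (\<lambda>l l'. mu_hat (l - l') = 0) ?F"
    by (rule orthogonal_setD[OF orthogonal_frequencies level_subset_frequencies])
  have "dist2 (expo t) (\<lambda>x. \<Sum>l\<in>?F. mu_hat (t - l) * expo l x) < \<epsilon>"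
    using n by (subst dist2_expo[OF _ orth]) (simp_all add: sum_level_frequencies del: sum.reindex)
  moreover have "(\<lambda>x. \<Sum>l\<in>?F. mu_hat (t - l) * expo l x) \<in> expo_span frequencies"
    unfolding expo_span_def using level_subset_frequencies[of n]
    by (intro CollectI exI[of _ ?F] exI[of _ "\<lambda>l. mu_hat (t - l)"] conjI refl) auto
  ultimately show "\<exists>g\<in>expo_span frequencies. dist2 (expo t) g < \<epsilon>" by blast
qed

text \<open>Every finite set of frequencies lies in one level, so the Bessel inequality keeps
  \<open>expo (- x)\<close> at squared distance at least d from the span.\<close>

lemma not_is_spectrum_frequencies:
  assumes "d > 0" and "\<And>n. bessel_sum n x \<le> 1 - d"
  shows "\<not> is_spectrum M frequencies"
proof
  assume "is_spectrum M frequencies"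
  then have "approximable frequencies (expo (- x))" by (simp add: is_spectrum_iff)
  then obtain g where "g \<in> expo_span frequencies" "dist2 (expo (- x)) g < d"
    using assms(1) unfolding approximable_def by meson
  then obtain F c where F: "finite F" "F \<subseteq> frequencies"
    "dist2 (expo (- x)) (\<lambda>x. \<Sum>l\<in>F. c l * expo l x) < d"
    by (auto simp: expo_span_def)
  obtain n where n: "F \<subseteq> (\<lambda>w. of_int (L w)) ` level n"
    using frequencies_level[OF F(1,2)] .
  have "(\<Sum>l\<in>F. (cmod (mu_hat (- x - l)))\<^sup>2)
      \<le> (\<Sum>l\<in>(\<lambda>w. of_int (L w)) ` level n. (cmod (mu_hat (- x - l)))\<^sup>2)"
    using n by (intro sum_mono2) auto
  also have "\<dots> \<le> 1 - d"
    using assms(2)[of n] by (simp only: sum_level_frequencies minus_minus)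
  finally show False
    using bessel_inequality[OF F(1) orthogonal_setD[OF orthogonal_frequencies F(2)], of "- x" c] F(3)
    by simp
qed

end

section \<open>Lower bounds for the transform\<close>

context self_similar_measure
begin

text \<open>Replacing y by y / b does not increase exp(6 |y|) |mu_hat y|, and along y / b^n this
  quantity tends to 1. Of the exponent 6 |y| the mask costs half, and the other half suffices for y
  / b since b >= 2.\<close>

lemma norm_mu_hat_ge_exp:
  assumes "\<bar>y\<bar> \<le> 2 / 3"
  shows "exp (- 6 * \<bar>y\<bar>) \<le> cmod (mu_hat y)"
proof -
  have step: "exp (6 * \<bar>y / real b\<bar>) * cmod (mu_hat (y / real b)) \<le> exp (6 * \<bar>y\<bar>) * cmod (mu_hat y)"
    if "\<bar>y\<bar> \<le> 2 / 3" for y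
  proof -
    have "6 * (\<bar>y\<bar> / real b) \<le> 6 * (\<bar>y\<bar> / 2)"
      using b_ge_2 by (intro mult_left_mono divide_left_mono) auto
    then have "exp (6 * \<bar>y / real b\<bar>) \<le> exp (6 * \<bar>y\<bar>) * exp (- 3 * \<bar>y\<bar>)"
      by (simp add: exp_add[symmetric])
    also have "\<dots> \<le> exp (6 * \<bar>y\<bar>) * cmod (cantor_mask q y)"
      using norm_cantor_mask_ge_exp[OF q_pos that] by simp
    finally have "exp (6 * \<bar>y / real b\<bar>) * cmod (mu_hat (y / real b))
        \<le> exp (6 * \<bar>y\<bar>) * cmod (cantor_mask q y) * cmod (mu_hat (y / real b))"
      by (rule mult_right_mono) simp
    then show ?thesis by (subst (2) mu_hat_rec) (simp add: norm_mult mult.assoc)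
  qed
  have small: "\<bar>y / real b ^ n\<bar> \<le> 2 / 3" for n
  proof -
    have "\<bar>y / real b ^ n\<bar> \<le> \<bar>y\<bar> / 1"
      unfolding abs_divide using b_ge_2 by (intro divide_left_mono) auto
    then show ?thesis using assms by linarith
  qed
  have "exp (6 * \<bar>y / real b ^ n\<bar>) * cmod (mu_hat (y / real b ^ n)) \<le> exp (6 * \<bar>y\<bar>) * cmod (mu_hat y)" for n
  proof (induction n)
    case (Suc n)
    have eq: "y / real b ^ Suc n = y / real b ^ n / real b" by (simp add: mult.commute)
    show ?case unfolding eq by (rule order.trans[OF step[OF small] Suc])
  qed simp
  moreover have "(\<lambda>n. exp (6 * \<bar>y / real b ^ n\<bar>) * cmod (mu_hat (y / real b ^ n)))
      \<longlonglongrightarrow> exp (6 * \<bar>0\<bar>) * cmod 1"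
    by (intro tendsto_intros div_power_tendsto_0 mu_hat_div_power_tendsto)
  ultimately have "exp (6 * \<bar>0\<bar>) * cmod 1 \<le> exp (6 * \<bar>y\<bar>) * cmod (mu_hat y)"
    by (intro LIMSEQ_le_const2) auto
  then show ?thesis by (simp add: exp_minus field_simps)
qed

text \<open>Digits are peeled off one by one: by periodicity the mask only sees y, and the rest is
  evaluated at y' = (y + e 0) / b plus the later digits. A digit thus costs 6 e 0 / b in the
  exponent once, so the loss depends on the digit sum and not on the number of positions.\<close>

lemma norm_mu_hat_ge_digits:
  assumes "2 * q \<le> b" and "b \<ge> 4" and "\<bar>y\<bar> \<le> 2 / 3" and "\<And>k. e k \<in> {0, int q}"
    and "q dvd b"
  shows "exp (- 6 * (\<bar>y\<bar> + of_int (\<Sum>k<N. e k) / real b))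
    \<le> cmod (mu_hat (y + of_int (\<Sum>k<N. e k * int b ^ k)))"
  using assms(3,4)
proof (induction N arbitrary: y e)
  case 0
  then show ?case using norm_mu_hat_ge_exp by simp
next
  case (Suc N)
  define B where "B = (\<Sum>k<N. e (Suc k) * int b ^ k)"
  define E where "E = (\<Sum>k<N. e (Suc k))"
  define y' where "y' = (y + of_int (e 0)) / real b"
  have sum_B: "(\<Sum>k<Suc N. e k * int b ^ k) = e 0 + int b * B"
    by (simp only: sum.lessThan_Suc_shift B_def sum_distrib_left) (simp add: mult_ac)
  have sum_E: "(\<Sum>k<Suc N. e k) = e 0 + E"
    by (simp only: sum.lessThan_Suc_shift E_def)
  have e0: "0 \<le> e 0" "e 0 \<le> int q" using Suc.prems(2)[of 0] by auto
  have y': "\<bar>y'\<bar> \<le> (\<bar>y\<bar> + of_int (e 0)) / real b"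
    unfolding y'_def abs_divide using e0 by (simp add: divide_right_mono)
  have "real_of_int (e 0) \<le> real q" using e0 by linarith
  moreover have "2 * real q \<le> real b" "4 \<le> real b" using assms(1,2) by linarith+
  \<comment> \<open>Namely 2/3 + q <= 2/3 + b/2 <= 2b/3, the last step by b >= 4.\<close>
  ultimately have "\<bar>y\<bar> + of_int (e 0) \<le> 2 / 3 * real b"
    using Suc.prems(1) by linarith
  then have "(\<bar>y\<bar> + of_int (e 0)) / real b \<le> 2 / 3"
    using assms(2) by (simp add: pos_divide_le_eq)
  with y' have "\<bar>y'\<bar> \<le> 2 / 3" by linarith
  then have "exp (- 6 * (\<bar>y'\<bar> + of_int E / real b)) \<le> cmod (mu_hat (y' + of_int B))"
    unfolding E_def B_def using Suc.prems(2) by (intro Suc.IH) auto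
  moreover have "exp (- 3 * \<bar>y\<bar>) \<le> cmod (cantor_mask q y)"
    by (rule norm_cantor_mask_ge_exp[OF q_pos Suc.prems(1)])
  ultimately have *: "exp (- 3 * \<bar>y\<bar>) * exp (- 6 * (\<bar>y'\<bar> + of_int E / real b))
      \<le> cmod (cantor_mask q y) * cmod (mu_hat (y' + of_int B))"
    by (intro mult_mono) auto
  have "6 * (\<bar>y\<bar> / real b) \<le> 6 * (\<bar>y\<bar> / 2)"
    using b_ge_2 by (intro mult_left_mono divide_left_mono) auto
  then have "- 6 * (\<bar>y\<bar> + of_int (e 0 + E) / real b) \<le> - 3 * \<bar>y\<bar> + - 6 * (\<bar>y'\<bar> + of_int E / real b)"
    using y' by (simp add: add_divide_distrib)
  then have "exp (- 6 * (\<bar>y\<bar> + of_int (e 0 + E) / real b)) \<le> exp (- 3 * \<bar>y\<bar>) * exp (- 6 * (\<bar>y'\<bar> + of_int E / real b))"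
    unfolding exp_add[symmetric] by simp
  also note *
  also have "cmod (cantor_mask q y) = cmod (cantor_mask q (y + of_int (e 0 + int b * B)))"
  proof -
    have "int q dvd e 0 + int b * B" using Suc.prems(2)[of 0] assms(5) by auto
    then obtain r where "e 0 + int b * B = int q * r" by blast
    then show ?thesis using cantor_mask_periodic[OF q_pos, of y r] by simp
  qed
  also have "y' + of_int B = (y + of_int (e 0 + int b * B)) / real b"
    using b_ge_2 by (simp add: y'_def field_simps)
  also have "cmod (cantor_mask q (y + of_int (e 0 + int b * B))) * cmod (mu_hat \<dots>)
      = cmod (mu_hat (y + of_int (e 0 + int b * B)))"
    by (subst (2) mu_hat_rec) (simp add: norm_mult)
  finally show ?case unfolding sum_B sum_E .
qed

end

section \<open>The two trees of the theorem\<close>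

context cantor_parameters
begin

abbreviation \<mu> :: "real measure" where "\<mu> \<equiv> cantor_measure q b"

sublocale \<mu>: cantor_space \<mu> q b 0 2
proof -
  have "q > 0" "b \<ge> 2" using q_ge_2 b_gt_4 by auto
  then interpret self_similar_measure \<mu> q b by (rule self_similar_cantor_measure)
  show "cantor_space \<mu> q b 0 2"
    using \<open>q > 0\<close> \<open>b \<ge> 2\<close> by unfold_locales (simp_all only: sets_M cantor_measure_AE)
qed

lemma coprime_pred_b: "coprime (int b) (int b - 1)"
proof (rule coprimeI)
  fix c assume "c dvd int b" "c dvd int b - 1"
  then show "is_unit c" using dvd_diff[of c "int b" "int b - 1"] by simp
qed

definition quotient :: "nat list \<Rightarrow> int" where
  "quotient w = frequency w div (int b - 1)"

lemma quotient_mult: "set w \<subseteq> {..<q} \<Longrightarrow> (int b - 1) * quotient w = frequency w"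
  using pred_b_dvd_frequency[of w] by (simp add: quotient_def)

lemma of_int_quotient:
  assumes "set w \<subseteq> {..<q}"
  shows "real_of_int (quotient w) = of_int (frequency w) / (real b - 1)"
proof -
  have "(real b - 1) * of_int (quotient w) = of_int (frequency w)"
    using arg_cong[OF quotient_mult[OF assms], of real_of_int] by simp
  then show ?thesis using b_gt_4 by (simp add: field_simps)
qed

sublocale \<Lambda>: cantor_tree \<mu> q b 0 2 frequency
  by unfold_locales
    (use q_dvd_b frequency_append_zeros[of _ 1] frequency_append_cong frequency_append_inj in auto)

text \<open>The congruences modulo powers of b can be divided by the coprime number b - 1;
  injectivity is inherited because divisibility passes from the quotients to their
  multiples.\<close>

sublocale \<Lambda>': cantor_tree \<mu> q b 0 2 quotient
proof unfold_locales
  fix w :: "nat list" and i j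
  assume w: "set w \<subseteq> {..<q}"
  show "quotient (w @ [0]) = quotient w"
    using frequency_append_zeros[OF w, of 1] by (simp add: quotient_def)
  have diff: "(int b - 1) * (quotient (w @ [i]) - quotient (w @ [j])) = frequency (w @ [i]) - frequency (w @ [j])"
    if "i < q" "j < q" for i j
    using quotient_mult[of "w @ [i]"] quotient_mult[of "w @ [j]"] w that by (simp add: right_diff_distrib)
  show "int b ^ length w dvd quotient (w @ [i]) - quotient w" if "i < q"
  proof -
    have "int b ^ length w dvd (int b - 1) * (quotient (w @ [i]) - quotient w)"
      using frequency_append_cong[OF w that] quotient_mult[of "w @ [i]"] quotient_mult[OF w] w that
      by (simp add: right_diff_distrib)
    moreover have "coprime (int b ^ length w) (int b - 1)"
      by (simp add: coprime_pred_b)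
    ultimately show ?thesis by (simp add: coprime_dvd_mult_right_iff)
  qed
  show "i = j" if "i < q" "j < q" "int b ^ length w * int q dvd quotient (w @ [i]) - quotient (w @ [j])"
  proof (rule frequency_append_inj[OF w that(1,2)])
    show "int b ^ length w * int q dvd frequency (w @ [i]) - frequency (w @ [j])"
      using that(3) diff[OF that(1,2)] by (metis dvd_mult)
  qed
qed (use q_dvd_b in simp)

lemma frequencies_eq: "\<Lambda>.frequencies = Lambda_set q b"
  by (simp add: \<Lambda>.frequencies_def Lambda_set_eq)

lemma quotient_frequencies_eq: "\<Lambda>'.frequencies = (\<lambda>x. x / (real b - 1)) ` Lambda_set q b"
  unfolding \<Lambda>'.frequencies_def Lambda_set_eq image_image
  by (intro image_cong refl) (simp add: of_int_quotient)

text \<open>From 2q <= b the fraction is at most b / (2 (b - 1)), which is 3/5 at b = 6 and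
  decreases.\<close>

lemma q_div_le: "real q / (real b - 1) \<le> 3 / 5"
proof -
  have "2 * real q \<le> real b" "6 \<le> real b" using two_q_le_b b_ge_6 by linarith+
  then show ?thesis by (simp add: field_simps)
qed

lemma digit_sum_bounds:
  assumes "set w \<subseteq> {..<q}"
  shows "0 \<le> real_of_int (\<Sum>k<n. kdigit w k * int b ^ k) / real b ^ n"
    and "real_of_int (\<Sum>k<n. kdigit w k * int b ^ k) / real b ^ n \<le> 3 / 5"
proof -
  define A where "A = (\<Sum>k<n. kdigit w k * int b ^ k)"
  have "0 \<le> A" unfolding A_def by (rule sum_kdigit_nonneg[OF assms])
  then show "0 \<le> real_of_int A / real b ^ n" by simp
  have "real_of_int (A * (int b - 1)) \<le> of_int (int q * (int b ^ n - 1))"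
    unfolding A_def of_int_le_iff by (rule sum_kdigit_le[OF assms])
  then have "real_of_int A * (real b - 1) \<le> real q * real b ^ n"
    by (simp add: right_diff_distrib)
  then have "real_of_int A / real b ^ n \<le> real q / (real b - 1)"
    using b_gt_4 by (simp add: field_simps)
  also note q_div_le
  finally show "real_of_int A / real b ^ n \<le> 3 / 5" .
qed

lemma is_spectrum_Lambda_set: "is_spectrum \<mu> (Lambda_set q b)"
  unfolding frequencies_eq[symmetric]
proof (rule \<Lambda>.is_spectrum_frequencies)
  fix x :: real
  \<comment> \<open>The 2/3 bounds |y|, and the digits behind the word sum to at most q b, which
    divided by b is q.\<close>
  define c where "c = exp (- 6 * (2 / 3 + real q))"
  \<comment> \<open>The room between 3/5, the bound for the digits of the word, and 2/3.\<close>
  have "eventually (\<lambda>n. \<bar>x / real b ^ n\<bar> < 1 / 15) sequentially"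
    using order_tendstoD(2)[OF tendsto_rabs_zero[OF \<mu>.div_power_tendsto_0[of x]], of "1 / 15"] by simp
  then obtain n0 where n0: "\<bar>x / real b ^ n\<bar> < 1 / 15" if "n \<ge> n0" for n
    by (auto simp: eventually_sequentially)
  show "(\<lambda>n. \<Lambda>.bessel_sum n x) \<longlonglongrightarrow> 1"
  proof (rule \<Lambda>.bessel_sum_tendsto_1)
    show "c\<^sup>2 > 0" by (simp add: c_def)
    fix n w assume n: "n \<ge> n0" and "w \<in> \<Lambda>.level n"
    then have w: "set w \<subseteq> {..<q}" "length w = n" by (auto simp: \<Lambda>.level_def)
    define A where "A = (\<Sum>k<n. kdigit w k * int b ^ k)"
    define N where "N = 2 * length w + 2 * b"
    define B where "B = (\<Sum>k<N. kdigit w (n + k) * int b ^ k)"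
    define y where "y = (x + of_int A) / real b ^ n"
    have "frequency w = A + int b ^ n * B"
      unfolding A_def B_def N_def by (rule frequency_split[OF w(1)])
    then have split: "(x + of_int (frequency w)) / real b ^ n = y + of_int B"
      using b_gt_4 by (simp add: y_def field_simps)
    have y: "\<bar>y\<bar> \<le> 2 / 3"
      using n0[OF n] digit_sum_bounds[OF w(1), of n] unfolding y_def A_def[symmetric] add_divide_distrib
      by linarith
    have "exp (- 6 * (\<bar>y\<bar> + of_int (\<Sum>k<N. kdigit w (n + k)) / real b)) \<le> cmod (\<mu>.mu_hat (y + of_int B))"
      unfolding B_def using two_q_le_b b_gt_4 y q_dvd_b kdigit_beyond_length[OF w(1)] w(2)
      by (intro \<mu>.norm_mu_hat_ge_digits) auto
    moreover have "of_int (\<Sum>k<N. kdigit w (n + k)) / real b \<le> real q"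
    proof -
      have "real_of_int (\<Sum>k<N. kdigit w (n + k)) \<le> of_int (int q * int b)"
        unfolding of_int_le_iff using sum_kdigit_beyond_length[OF w(1), of N] w(2) by simp
      then show ?thesis using b_gt_4 by (simp add: pos_divide_le_eq)
    qed
    then have "c \<le> exp (- 6 * (\<bar>y\<bar> + of_int (\<Sum>k<N. kdigit w (n + k)) / real b))"
      using y by (simp add: c_def)
    ultimately have "c \<le> cmod (\<mu>.mu_hat (y + of_int B))" by simp
    then show "c\<^sup>2 \<le> \<Lambda>.power_spectrum ((x + of_int (frequency w)) / real b ^ n)"
      unfolding split \<Lambda>.power_spectrum_def by (intro power_mono) (auto simp: c_def)
  qed
qed

lemma maximal_orthogonal_quotients: "maximal_orthogonal_set \<mu> \<Lambda>'.frequencies"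
  unfolding maximal_orthogonal_set_def
proof (intro conjI allI impI notI \<Lambda>'.orthogonal_frequencies)
  fix l0 assume l0: "l0 \<notin> \<Lambda>'.frequencies" and orth: "orthogonal_set \<mu> (insert l0 \<Lambda>'.frequencies)"
  have "real b - 1 > 0" using b_gt_4 by simp
  \<comment> \<open>The candidate is scaled up by b - 1, where completeness supplies a frequency to
    which it is not orthogonal.\<close>
  obtain l where l: "l \<in> Lambda_set q b" "\<mu>.mu_hat ((real b - 1) * l0 - l) \<noteq> 0"
    using \<mu>.spectrum_not_orthogonal[OF is_spectrum_Lambda_set] by blast
  define l' where "l' = l / (real b - 1)"
  have l': "l' \<in> \<Lambda>'.frequencies" using l(1) unfolding l'_def quotient_frequencies_eq by (rule imageI)
  then have "\<mu>.mu_hat (l0 - l') = 0"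
    using l0 \<mu>.orthogonal_setD[OF orth order.refl] by (auto simp: pairwise_def)
  then obtain j k where jk: "l0 - l' = real b ^ j * of_int k" "\<not> int q dvd k"
    unfolding \<mu>.mu_hat_eq_0_iff by blast
  have "(real b - 1) * l0 - l = (real b - 1) * (l0 - l')"
    using \<open>real b - 1 > 0\<close> by (simp add: l'_def right_diff_distrib)
  also have "\<dots> = real b ^ j * of_int ((int b - 1) * k)"
    unfolding jk(1) by (simp add: algebra_simps)
  finally have eq: "(real b - 1) * l0 - l = real b ^ j * of_int ((int b - 1) * k)" .
  have "coprime (int q) (int b - 1)"
    using q_dvd_b coprime_pred_b coprime_divisors[of "int q" "int b" "int b - 1" "int b - 1"] by simp
  then have "\<not> int q dvd (int b - 1) * k"
    using jk(2) by (simp add: coprime_dvd_mult_right_iff)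
  with eq l(2) show False unfolding \<mu>.mu_hat_eq_0_iff by blast
qed

text \<open>The quotient of \<open>q b^N\<close> by \<open>b - 1\<close> has the digits \<open>q\<close> in all positions below \<open>N\<close>, so that
  about \<open>length d\<close> factors of the transform are evaluated close to \<open>q / (b - 1)\<close>.\<close>

lemma cantor_mask_quotient:
  assumes "d \<noteq> []" and "set d \<subseteq> {..<q}" and "last d \<noteq> 0" and "i < length d"
  obtains y where "y \<in> {real q / (real b - 1)..9 / 10}"
    and "cantor_mask q ((1 / 2 + of_int (quotient d)) / real b ^ (length d + b - 2 + i)) = cantor_mask q y"
proof
  define J where "J = length d + b - 2"
  define j where "j = J + i"
  define N where "N = 2 * length d + 2 * b - 2"
  define A where "A = (\<Sum>k<J. kdigit d k * int b ^ k)"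
  define y where "y = real q / (real b - 1) + (1 / 2 + of_int A / (real b - 1)) / real b ^ j"
  have bpos: "real b - 1 > 0" "real b > 0" using b_gt_4 by auto
  \<comment> \<open>As i < \<open>length d\<close>, the position j does not pass the isolated digit;
    this provides as many small factors as the word has letters.\<close>
  have "j \<le> N" using assms(4) b_gt_4 by (simp add: j_def J_def N_def)
  have freq: "frequency d = A + int q * int b ^ N"
    unfolding A_def J_def N_def by (rule frequency_stripped[OF assms(1-3)])
  \<comment> \<open>The block of ones left by the division: q b^(N - j) / (b - 1) = q / (b - 1) + q
    s, and periodicity removes q s.\<close>
  define s where "s = (\<Sum>k<N - j. int b ^ k)"
  have s: "real b ^ (N - j) = 1 + (real b - 1) * of_int s"
  proof -
    have "int b ^ (N - j) - 1 = (int b - 1) * s" by (simp add: s_def power_diff_1_eq)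
    then have "int b ^ (N - j) = 1 + (int b - 1) * s" by linarith
    from arg_cong[OF this, of real_of_int] show ?thesis by simp
  qed
  have "real b ^ N = real b ^ j * real b ^ (N - j)"
    using \<open>j \<le> N\<close> by (simp add: power_add[symmetric])
  then have "real b ^ N / real b ^ j = 1 + (real b - 1) * of_int s"
    using bpos by (simp add: s)
  have "(1 / 2 + of_int (quotient d)) / real b ^ j
      = (1 / 2 + (of_int A / (real b - 1) + real q * real b ^ N / (real b - 1))) / real b ^ j"
    by (simp add: of_int_quotient[OF assms(2)] freq add_divide_distrib)
  also have "\<dots> = (1 / 2 + of_int A / (real b - 1)) / real b ^ j + real q / (real b - 1) * (real b ^ N / real b ^ j)"
    by (simp add: add_divide_distrib)
  also have "\<dots> = y + real q * of_int s"
    unfolding \<open>real b ^ N / real b ^ j = _\<close> y_def using bpos by (simp add: distrib_left)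
  finally show "cantor_mask q ((1 / 2 + of_int (quotient d)) / real b ^ (length d + b - 2 + i)) = cantor_mask q y"
    using cantor_mask_periodic[of q y s] q_ge_2 by (simp add: j_def J_def)
  have A: "0 \<le> of_int A / real b ^ J" "of_int A / real b ^ J \<le> 3 / 5"
    unfolding A_def by (rule digit_sum_bounds[OF assms(2)])+
  have "A \<ge> 0" unfolding A_def by (rule sum_kdigit_nonneg[OF assms(2)])
  have "real b ^ J \<le> real b ^ j" using b_gt_4 by (simp add: j_def)
  then have "of_int A / real b ^ j \<le> of_int A / real b ^ J"
    using \<open>A \<ge> 0\<close> bpos by (intro divide_left_mono) auto
  then have A_j: "of_int A / real b ^ j \<le> 3 / 5" using A by linarith
  \<comment> \<open>The excess of y over q / (b - 1) is h + a, with h from the point 1/2 and a from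
    the lower digits; then 3/5 + 1/12 + 3/25 < 9/10.\<close>
  define h where "h = 1 / 2 / real b ^ j"
  define a where "a = of_int A / real b ^ j / (real b - 1)"
  have "a \<le> of_int A / real b ^ j / 5"
    unfolding a_def using \<open>A \<ge> 0\<close> b_ge_6 by (intro divide_left_mono) auto
  also have "\<dots> \<le> 3 / 5 / 5" using A_j by (rule divide_right_mono) simp
  finally have "a \<le> 3 / 25" by simp
  moreover have "h \<le> 1 / 2 / 6"
    unfolding h_def
  proof (rule divide_left_mono)
    have "real b ^ 1 \<le> real b ^ j"
      using b_gt_4 assms(1) by (intro power_increasing) (auto simp: j_def J_def)
    moreover have "6 \<le> real b" using b_ge_6 by simp
    ultimately show "6 \<le> real b ^ j" unfolding power_one_right by linarith
  qed (use bpos in auto)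
  moreover have "y = real q / (real b - 1) + h + a"
    by (simp add: y_def h_def a_def add_divide_distrib mult.commute)
  moreover have "0 \<le> h" "0 \<le> a"
    unfolding h_def a_def using \<open>A \<ge> 0\<close> bpos by simp_all
  ultimately show "y \<in> {real q / (real b - 1)..9 / 10}"
    using q_div_le unfolding atLeastAtMost_iff by (intro conjI) linarith+
qed

lemma not_is_spectrum_quotients: "\<not> is_spectrum \<mu> \<Lambda>'.frequencies"
proof -
  have q0: "0 < real q / (real b - 1)" using q_ge_2 b_gt_4 by simp
  let ?I = "{real q / (real b - 1)..9 / 10}"
  \<comment> \<open>Compactness gives one bound for all words; it is below 1 because the interval
    lies strictly between 0 and 1.\<close>
  have "\<exists>z\<in>?I. \<forall>y\<in>?I. cmod (cantor_mask q y) \<le> cmod (cantor_mask q z)"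
  proof (rule continuous_attains_sup)
    have "real q / (real b - 1) \<in> ?I"
      using q_div_le unfolding atLeastAtMost_iff by linarith
    then show "?I \<noteq> {}" by blast
  qed (auto intro: continuous_on_norm continuous_cantor_mask)
  then obtain z where z: "z \<in> ?I" "\<And>y. y \<in> ?I \<Longrightarrow> cmod (cantor_mask q y) \<le> cmod (cantor_mask q z)"
    by blast
  define r where "r = (cmod (cantor_mask q z))\<^sup>2"
  have "cmod (cantor_mask q z) < 1"
    using z(1) q0 q_ge_2 by (intro norm_cantor_mask_less_1) auto
  then have r: "0 \<le> r" "r < 1" by (auto simp: r_def power_less_one_iff abs_square_less_1)
  obtain \<delta> where "\<delta> > 0" "\<And>n. \<Lambda>'.bessel_sum n (1 / 2) \<le> 1 - \<delta>"
  proof (rule \<Lambda>'.bessel_sum_bounded_below_1[OF r])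
    \<comment> \<open>Level 0 has a single term, at 1/2 itself, and the mask there is already below
      1 in absolute value.\<close>
    have "\<Lambda>'.power_spectrum (1 / 2) \<le> \<Lambda>'.partial_spectrum 1 (1 / 2)"
      by (rule \<Lambda>'.power_spectrum_le_partial)
    also have "\<dots> < 1"
      using norm_cantor_mask_less_1[OF q_ge_2, of "1 / 2"]
      by (simp add: \<Lambda>'.partial_spectrum_def abs_square_less_1)
    finally show "\<Lambda>'.bessel_sum 0 (1 / 2) < 1"
      using kdigit_zeros[of 0]
      by (simp add: \<Lambda>'.bessel_sum_def \<Lambda>'.level_0 quotient_def frequency_def)
  next
    fix n w assume "w \<in> \<Lambda>'.level (Suc n)" and last: "last w \<noteq> 0"
    then have w: "w \<noteq> []" "set w \<subseteq> {..<q}" "length w = Suc n" by (auto simp: \<Lambda>'.level_def)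
    let ?x = "1 / 2 + real_of_int (quotient w)"
    \<comment> \<open>The b - 2 factors at the positions open to the run are dropped; each of the
      next n + 1 is at most r.\<close>
    have "\<Lambda>'.power_spectrum (?x / real b ^ Suc n)
        \<le> \<Lambda>'.power_spectrum (?x / real b ^ Suc n / real b ^ (b - 2))"
      by (subst \<Lambda>'.power_spectrum_eq[of _ "b - 2"])
         (simp add: \<Lambda>'.partial_spectrum_le_1 mult_left_le_one_le)
    also have "?x / real b ^ Suc n / real b ^ (b - 2) = ?x / real b ^ (length w + b - 2)"
    proof -
      have "length w + b - 2 = Suc n + (b - 2)" using b_gt_4 by (simp add: w(3))
      then show ?thesis by (simp only: power_add divide_divide_eq_left)
    qed
    also have "\<Lambda>'.power_spectrum \<dots> \<le> \<Lambda>'.partial_spectrum (Suc n) \<dots>"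
      by (rule \<Lambda>'.power_spectrum_le_partial)
    also have "\<dots> \<le> (\<Prod>i<Suc n. r)"
      unfolding \<Lambda>'.partial_spectrum_def
    proof (rule prod_mono, intro conjI)
      fix i assume "i \<in> {..<Suc n}"
      then have "i < length w" by (simp add: w(3))
      then obtain y where "y \<in> {real q / (real b - 1)..9 / 10}"
        "cantor_mask q (?x / real b ^ (length w + b - 2 + i)) = cantor_mask q y"
        using cantor_mask_quotient[OF w(1,2) last] by blast
      then have "cmod (cantor_mask q (?x / real b ^ (length w + b - 2) / real b ^ i)) \<le> cmod (cantor_mask q z)"
        using z(2) by (simp add: power_add)
      then show "(cmod (cantor_mask q (?x / real b ^ (length w + b - 2) / real b ^ i)))\<^sup>2 \<le> r"
        unfolding r_def by (intro power_mono) auto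
    qed simp
    also have "\<dots> = r ^ Suc n" by simp
    finally show "\<Lambda>'.power_spectrum (?x / real b ^ Suc n) \<le> r ^ Suc n" .
  qed (use that in blast)
  then show ?thesis by (rule \<Lambda>'.not_is_spectrum_frequencies)
qed

end

theorem theorem5p2:
  fixes q b :: nat
  assumes "q \<ge> 2" and "q dvd b" and "b div q \<ge> 2" and "b > 4"
  shows "is_spectrum (cantor_measure q b) (Lambda_set q b)
       \<and> maximal_orthogonal_set (cantor_measure q b)
           ((\<lambda>x. x / (real b - 1)) ` Lambda_set q b)
       \<and> \<not> is_spectrum (cantor_measure q b)
           ((\<lambda>x. x / (real b - 1)) ` Lambda_set q b)"
proof -
  interpret cantor_parameters q b
    by unfold_locales (fact assms)+
  show ?thesis
    using is_spectrum_Lambda_set maximal_orthogonal_quotients not_is_spectrum_quotients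
    unfolding quotient_frequencies_eq by blast
qed

end
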